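(* Let $H$ be a hexagonal ring with $n$ hexagons and type $M_1M_2\cdots M_n$, where each $M_i\in\{t(1),t(2),t(3)\}$. Then the number of maximal matchings of $H$ is $$\Psi(H)=\operatorname{tr}\Big(\prod_{i=1}^{n} f(M_i)\Big)=\operatorname{tr}\big(f(M_1)f(M_2)\cdots f(M_n)\big),$$ where $f(t(1))=L$, $f(t(2))=S$, $f(t(3))=R$, and $\operatorname{tr}$ denotes the trace of a matrix.
   Context: A matching of a graph is maximal if it is not contained in any larger matching; $\Psi(X)$ denotes the number of maximal matchings of a graph $X$. A hexagonal ring with $n$ hexagons is a 2-connected plane graph obtained as follows. There are $n$ hexagons (6-cycles) $H_1,\dots,H_n$ (the faces), arranged cyclically: for $i=2,\dots,n$ the hexagons $H_{i-1}$ and $H_i$ share exactly one edge $e_i$, the hexagons $H_n$ and $H_1$ share exactly one edge $e_1$, no other pair of hexagons shares an edge, and every vertex lies on at most two hexagons. Fix a planar embedding, so that each hexagon has a clockwise direction. For each $i$ (indices mod $n$, $e_{n+1}=e_1$), let $k_i\in\{1,2,3\}$ be the number of edges of $H_i$ lying strictly between $e_i$ and $e_{i+1}$ when $H_i$ is traversed clockwise starting from $e_i$. The type of $H$ is $M_1M_2\cdots M_n$ with $M_i=t(k_i)$ (so $t(2)$ is linear, $t(1)$ left angular, $t(3)$ right angular attachment). The matrices are $$S=\begin{pmatrix} 1&1&1&1&1&1&1&0&0\\ 0&1&0&1&0&0&1&1&0\\ 0&0&1&1&0&1&0&0&1\\ 0&0&0&1&1&1&1&0&0\\ 1&0&0&1&1&1&1&0&0\\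 0&1&0&0&0&0&0&1&0\\ 0&0&1&0&0&0&0&0&1\\ 1&0&1&1&1&1&1&0&0\\ 1&1&0&1&1&1&1&0&0 \end{pmatrix},\quad L=\begin{pmatrix} 1&1&1&1&1&1&1&0&0\\ 1&0&1&0&0&0&0&0&1\\ 0&1&0&1&0&0&1&1&0\\ 1&0&1&0&0&0&0&0&0\\ 1&0&1&1&0&1&0&0&0\\ 0&0&1&0&0&0&0&0&1\\ 0&1&0&1&0&0&0&0&0\\ 1&1&1&1&0&1&0&0&0\\ 1&0&1&1&1&1&1&0&0 \end{pmatrix},\quad R=\begin{pmatrix} 1&1&1&1&1&1&1&0&0\\ 0&0&1&1&0&1&0&0&1\\ 1&1&0&0&0&0&0&1&0\\ 1&1&0&0&0&0&0&0&0\\ 1&1&0&1&0&0&1&0&0\\ 0&0&1&1&0&0&0&0&0\\ 0&1&0&0&0&0&0&1&0\\ 1&1&0&1&1&1&1&0&0\\ 1&1&1&1&0&0&1&0&0 \end{pmatrix}.$$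
   Formalization: Hexagons are also required to meet only in the shared edges e_i and their ends; if two hexagons may touch in a further vertex the formula fails (n=4, all linear, inner midpoints of two opposite hexagons identified: 211 maximal matchings, not tr(S^4)=265). *)

theory Defs
  imports
    "Graph_Theory.Digraph_Component"
    "HOL-Combinatorics.Orbits"
    "Jordan_Normal_Form.Matrix"
begin

section \<open>Maximal matchings\<close>

text \<open>A finite simple graph is a \<open>pair_graph\<close>, whose arcs are the two orientations (darts) of
  each undirected edge; an edge is the two-element set of its ends.\<close>

definition dart_edge :: "'a \<times> 'a \<Rightarrow> 'a set" where
  "dart_edge d = {fst d, snd d}"

definition graph_edges :: "'a pair_pre_digraph \<Rightarrow> 'a set set" where
  "graph_edges G = dart_edge ` parcs G"

definition is_matching :: "'a pair_pre_digraph \<Rightarrow> 'a set set \<Rightarrow> bool" where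
  "is_matching G M \<longleftrightarrow> M \<subseteq> graph_edges G \<and> (\<forall>a\<in>M. \<forall>b\<in>M. a \<noteq> b \<longrightarrow> a \<inter> b = {})"

definition is_maximal_matching :: "'a pair_pre_digraph \<Rightarrow> 'a set set \<Rightarrow> bool" where
  "is_maximal_matching G M \<longleftrightarrow> is_matching G M \<and> \<not> (\<exists>M'. is_matching G M' \<and> M \<subset> M')"

definition num_maximal_matchings :: "'a pair_pre_digraph \<Rightarrow> nat" where
  "num_maximal_matchings G = card {M. is_maximal_matching G M}"

section \<open>Plane graphs\<close>

text \<open>An embedding is given by its rotation system: \<open>rot\<close> sends a dart to the next dart,
  counterclockwise, around the same tail. Arriving at \<open>v\<close> along \<open>(u, v)\<close> and leaving along
  \<open>rot (v, u)\<close> then keeps the face on the right-hand side, so each orbit of \<open>face_step rot\<close> is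
  the boundary of one face, and bounded faces are traversed clockwise.\<close>

definition face_step :: "('a \<times> 'a \<Rightarrow> 'a \<times> 'a) \<Rightarrow> 'a \<times> 'a \<Rightarrow> 'a \<times> 'a" where
  "face_step rot = rot \<circ> prod.swap"

definition faces :: "'a pair_pre_digraph \<Rightarrow> ('a \<times> 'a \<Rightarrow> 'a \<times> 'a) \<Rightarrow> ('a \<times> 'a) set set" where
  "faces G rot = orbit (face_step rot) ` parcs G"

definition face_verts :: "('a \<times> 'a) set \<Rightarrow> 'a set" where
  "face_verts F = fst ` F"

definition face_edges :: "('a \<times> 'a) set \<Rightarrow> 'a set set" where
  "face_edges F = dart_edge ` F"

text \<open>The last conjunct is Euler's formula, saying that the rotation system has genus 0. It is the
  right formula for connected graphs with at least one edge (an edgeless graph has no dart and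
  hence no orbit).\<close>

definition plane_graph :: "'a pair_pre_digraph \<Rightarrow> ('a \<times> 'a \<Rightarrow> 'a \<times> 'a) \<Rightarrow> bool" where
  "plane_graph G rot \<longleftrightarrow>
     pair_graph G \<and> connected (with_proj G) \<and>
     rot permutes parcs G \<and>
     (\<forall>v\<in>pverts G. out_arcs (with_proj G) v \<noteq> {} \<longrightarrow> cyclic_on rot (out_arcs (with_proj G) v)) \<and>
     card (pverts G) + card (faces G rot) = card (graph_edges G) + 2"

definition two_connected :: "'a pair_pre_digraph \<Rightarrow> bool" where
  "two_connected G \<longleftrightarrow>
     3 \<le> card (pverts G) \<and> connected (with_proj G) \<and>
     (\<forall>v\<in>pverts G. connected (pre_digraph.del_vert (with_proj G) v))"

section \<open>Hexagonal rings\<close>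

text \<open>A face whose boundary is a 6-cycle.\<close>

definition is_hexagon ::
  "'a pair_pre_digraph \<Rightarrow> ('a \<times> 'a \<Rightarrow> 'a \<times> 'a) \<Rightarrow> ('a \<times> 'a) set \<Rightarrow> bool" where
  "is_hexagon G rot F \<longleftrightarrow> F \<in> faces G rot \<and> card F = 6 \<and> card (face_verts F) = 6"

text \<open>The hexagons are \<open>H 0, \<dots>, H (n - 1)\<close>, and \<open>e i\<close> is the edge that \<open>H i\<close> shares with its
  cyclic predecessor. Hexagons meet only along shared edges: consecutive ones have no common vertex
  besides the ends of the shared edge, others are disjoint. (Two hexagons touching in a single
  vertex would pinch the ring.) The bound \<open>3 \<le> n\<close> is what makes \<open>e i\<close> and \<open>e (i + 1)\<close> two
  different edges while any two hexagons share at most one.\<close>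

definition hexagonal_ring ::
  "'a pair_pre_digraph \<Rightarrow> ('a \<times> 'a \<Rightarrow> 'a \<times> 'a) \<Rightarrow> nat \<Rightarrow> (nat \<Rightarrow> ('a \<times> 'a) set) \<Rightarrow>
    (nat \<Rightarrow> 'a set) \<Rightarrow> bool" where
  "hexagonal_ring G rot n H e \<longleftrightarrow>
     plane_graph G rot \<and> two_connected G \<and> 3 \<le> n \<and>
     (\<forall>i<n. is_hexagon G rot (H i)) \<and>
     pverts G = (\<Union>i<n. face_verts (H i)) \<and>
     graph_edges G = (\<Union>i<n. face_edges (H i)) \<and>
     (\<forall>i<n. face_edges (H i) \<inter> face_edges (H (Suc i mod n)) = {e (Suc i mod n)} \<and>
            face_verts (H i) \<inter> face_verts (H (Suc i mod n)) = e (Suc i mod n)) \<and>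
     (\<forall>i<n. \<forall>j<n. i \<noteq> j \<and> j \<noteq> Suc i mod n \<and> i \<noteq> Suc j mod n \<longrightarrow>
            face_edges (H i) \<inter> face_edges (H j) = {} \<and>
            face_verts (H i) \<inter> face_verts (H j) = {}) \<and>
     (\<forall>v\<in>pverts G. card {i. i < n \<and> v \<in> face_verts (H i)} \<le> 2)"

text \<open>The number of steps from the dart following \<open>a\<close> to the dart on \<open>b\<close> is the number of edges
  strictly between \<open>a\<close> and \<open>b\<close> on the clockwise boundary of \<open>F\<close>.\<close>

definition edges_between ::
  "('a \<times> 'a \<Rightarrow> 'a \<times> 'a) \<Rightarrow> ('a \<times> 'a) set \<Rightarrow> 'a set \<Rightarrow> 'a set \<Rightarrow> nat" where
  "edges_between rot F a b =
     funpow_dist (face_step rot)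
       (face_step rot (THE d. d \<in> F \<and> dart_edge d = a)) (THE d. d \<in> F \<and> dart_edge d = b)"

datatype attachment = Left_Angular | Linear | Right_Angular

text \<open>\<open>M = t(k)\<close> is expressed as \<open>attachment_size M = k\<close>.\<close>

fun attachment_size :: "attachment \<Rightarrow> nat" where
  "attachment_size Left_Angular = 1"
| "attachment_size Linear = 2"
| "attachment_size Right_Angular = 3"

definition has_ring_type ::
  "('a \<times> 'a \<Rightarrow> 'a \<times> 'a) \<Rightarrow> nat \<Rightarrow> (nat \<Rightarrow> ('a \<times> 'a) set) \<Rightarrow> (nat \<Rightarrow> 'a set) \<Rightarrow>
    attachment list \<Rightarrow> bool" where
  "has_ring_type rot n H e Ms \<longleftrightarrow>
     length Ms = n \<and>
     (\<forall>i<n. edges_between rot (H i) (e i) (e (Suc i mod n)) = attachment_size (Ms ! i))"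

section \<open>Transfer matrices\<close>

definition mat_S :: "int mat" where
  "mat_S = mat_of_rows_list 9
    [[1,1,1,1,1,1,1,0,0],
     [0,1,0,1,0,0,1,1,0],
     [0,0,1,1,0,1,0,0,1],
     [0,0,0,1,1,1,1,0,0],
     [1,0,0,1,1,1,1,0,0],
     [0,1,0,0,0,0,0,1,0],
     [0,0,1,0,0,0,0,0,1],
     [1,0,1,1,1,1,1,0,0],
     [1,1,0,1,1,1,1,0,0]]"

definition mat_L :: "int mat" where
  "mat_L = mat_of_rows_list 9
    [[1,1,1,1,1,1,1,0,0],
     [1,0,1,0,0,0,0,0,1],
     [0,1,0,1,0,0,1,1,0],
     [1,0,1,0,0,0,0,0,0],
     [1,0,1,1,0,1,0,0,0],
     [0,0,1,0,0,0,0,0,1],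
     [0,1,0,1,0,0,0,0,0],
     [1,1,1,1,0,1,0,0,0],
     [1,0,1,1,1,1,1,0,0]]"

definition mat_R :: "int mat" where
  "mat_R = mat_of_rows_list 9
    [[1,1,1,1,1,1,1,0,0],
     [0,0,1,1,0,1,0,0,1],
     [1,1,0,0,0,0,0,1,0],
     [1,1,0,0,0,0,0,0,0],
     [1,1,0,1,0,0,1,0,0],
     [0,0,1,1,0,0,0,0,0],
     [0,1,0,0,0,0,0,1,0],
     [1,1,0,1,1,1,1,0,0],
     [1,1,1,1,0,0,1,0,0]]"

fun attachment_mat :: "attachment \<Rightarrow> int mat" where
  "attachment_mat Left_Angular = mat_L"
| "attachment_mat Linear = mat_S"
| "attachment_mat Right_Angular = mat_R"

definition mat_trace :: "'a::comm_monoid_add mat \<Rightarrow> 'a" where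
  "mat_trace A = (\<Sum>i<dim_row A. A $$ (i, i))"

end

theory Submission
  imports Defs
begin

text \<open>
  Call the shared edges rungs, and orient the rung between two consecutive hexagons as a pair of
  ends \<open>u\<close>, \<open>v\<close> so that all \<open>v\<close>-ends lie on one boundary cycle of the ring and all \<open>u\<close>-ends on the
  other. A matching meets a rung in one of 9 ways: the rung is used, or each end is matched
  backwards, matched forwards or unmatched, but not both unmatched. The states of the two rungs of
  a hexagon determine a maximal matching inside it: an edge whose membership they leave open has
  two neighbours which are both absent only if it is present. So maximal matchings correspond to
  closed walks of states, and \<open>\<Psi>\<close> is the trace of a product of 0/1 transfer matrices \<open>A(M\<^sub>i)\<close>.

  These are not the matrices of the theorem, nor simultaneously conjugate to them, but there are
  \<open>U\<close> and \<open>V(M)\<close> with \<open>f(M) = U V(M)\<close> and \<open>A(M) = V(M) U\<close>, so the two products have the same trace.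
\<close>

section \<open>Traces of matrix products\<close>

lemma mat_trace_mult_comm:
  fixes A B :: "'a::comm_semiring_0 mat"
  assumes "A \<in> carrier_mat m n" "B \<in> carrier_mat n m"
  shows "mat_trace (A * B) = mat_trace (B * A)"
proof -
  have "mat_trace (A * B) = (\<Sum>i<m. \<Sum>j<n. A $$ (i, j) * B $$ (j, i))"
    using assms by (auto simp: mat_trace_def scalar_prod_def atLeast0LessThan intro!: sum.cong)
  also have "\<dots> = (\<Sum>j<n. \<Sum>i<m. B $$ (j, i) * A $$ (i, j))"
    by (subst sum.swap) (simp add: mult.commute)
  also have "\<dots> = mat_trace (B * A)"
    using assms by (auto simp: mat_trace_def scalar_prod_def atLeast0LessThan intro!: sum.cong)
  finally show ?thesis .
qed

lemma foldr_mult_carrier_mat: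
  assumes "\<And>A. A \<in> set As \<Longrightarrow> A \<in> carrier_mat N N"
  shows "foldr (*) As (1\<^sub>m N) \<in> carrier_mat N N"
  using assms by (induction As) (auto intro!: mult_carrier_mat)

text \<open>Only brackets move: \<open>(U * V x) * U\<close> is \<open>U * (V x * U)\<close>, so a
  \<open>U\<close> at the right end passes leftwards through the whole product.\<close>

lemma foldr_mult_intertwine:
  fixes U :: "'a::semiring_1 mat"
  assumes U: "U \<in> carrier_mat N N" and V: "\<And>x. V x \<in> carrier_mat N N"
  shows "foldr (*) (map (\<lambda>x. U * V x) xs) (1\<^sub>m N) * U =
         U * foldr (*) (map (\<lambda>x. V x * U) xs) (1\<^sub>m N)"
proof (induction xs)
  case Nil
  then show ?case using U by simp
next
  case (Cons x xs)
  define P where "P = foldr (*) (map (\<lambda>x. U * V x) xs) (1\<^sub>m N)"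
  define P' where "P' = foldr (*) (map (\<lambda>x. V x * U) xs) (1\<^sub>m N)"
  have P: "P \<in> carrier_mat N N" and P': "P' \<in> carrier_mat N N"
    unfolding P_def P'_def by (rule foldr_mult_carrier_mat; use U V in \<open>auto intro!: mult_carrier_mat\<close>)+
  have "U * V x * P * U = U * V x * (P * U)"
    using U V P by (intro assoc_mult_mat[of _ N N _ N _ N]) auto
  also have "\<dots> = U * V x * (U * P')"
    using Cons.IH by (simp add: P_def P'_def)
  also have "\<dots> = U * (V x * (U * P'))"
    using U V P' by (intro assoc_mult_mat[of _ N N _ N _ N]) auto
  also have "V x * (U * P') = V x * U * P'"
    using U V P' by (intro assoc_mult_mat[of _ N N _ N _ N, symmetric]) auto
  finally show ?case by (simp add: P_def P'_def)
qed

text \<open>Cyclicity of the trace carries the leading \<open>U\<close> to the right end, and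
  intertwining pulls it back through all factors but the first \<open>V y\<close>.\<close>

lemma mat_trace_foldr_mult_rotate:
  fixes U :: "'a::comm_semiring_1 mat"
  assumes U: "U \<in> carrier_mat N N" and V: "\<And>x. V x \<in> carrier_mat N N" and "xs \<noteq> []"
  shows "mat_trace (foldr (*) (map (\<lambda>x. U * V x) xs) (1\<^sub>m N)) =
         mat_trace (foldr (*) (map (\<lambda>x. V x * U) xs) (1\<^sub>m N))"
proof -
  obtain y ys where xs: "xs = y # ys"
    using assms(3) by (cases xs) auto
  define P where "P = foldr (*) (map (\<lambda>x. U * V x) ys) (1\<^sub>m N)"
  define P' where "P' = foldr (*) (map (\<lambda>x. V x * U) ys) (1\<^sub>m N)"
  have P: "P \<in> carrier_mat N N" and P': "P' \<in> carrier_mat N N"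
    unfolding P_def P'_def by (rule foldr_mult_carrier_mat; use U V in \<open>auto intro!: mult_carrier_mat\<close>)+
  have "U * V y * P = U * (V y * P)"
    using U V P by (intro assoc_mult_mat[of _ N N _ N _ N]) auto
  then have "mat_trace (U * V y * P) = mat_trace (V y * P * U)"
    using U V P mat_trace_mult_comm[of U N N "V y * P"] by (auto intro!: mult_carrier_mat)
  also have "V y * P * U = V y * (P * U)"
    using U V P by (intro assoc_mult_mat[of _ N N _ N _ N]) auto
  also have "\<dots> = V y * (U * P')"
    using foldr_mult_intertwine[of U N V ys] U V by (simp add: P_def P'_def)
  also have "\<dots> = V y * U * P'"
    using U V P' by (intro assoc_mult_mat[of _ N N _ N _ N, symmetric]) auto
  finally show ?thesis by (simp add: xs P_def P'_def)
qed

section \<open>Products of 0/1 matrices count walks\<close>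

definition walks :: "nat \<Rightarrow> ('b \<Rightarrow> nat \<Rightarrow> nat \<Rightarrow> bool) \<Rightarrow> 'b list \<Rightarrow> nat list set" where
  "walks N R ks = {xs. length xs = Suc (length ks) \<and> set xs \<subseteq> {..<N} \<and>
     (\<forall>i<length ks. R (ks ! i) (xs ! i) (xs ! Suc i))}"

lemma finite_walks: "finite (walks N R ks)"
  by (rule finite_subset[OF _ finite_lists_length_eq[of "{..<N}" "Suc (length ks)"]])
    (auto simp: walks_def)

lemma all_less_Suc_eq0: "(\<forall>i<Suc n. P i) \<longleftrightarrow> P 0 \<and> (\<forall>i<n. P (Suc i))"
  by (auto simp: less_Suc_eq_0_disj)

lemma walks_Cons_iff:
  "a # xs \<in> walks N R (k # ks) \<longleftrightarrow> a < N \<and> R k a (xs ! 0) \<and> xs \<in> walks N R ks"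
  by (simp add: walks_def all_less_Suc_eq0) auto

lemma foldr_mult_index_eq_card_walks:
  assumes "a < N" "b < N"
  shows "foldr (*) (map (\<lambda>k. mat N N (\<lambda>(i, j). of_bool (R k i j) :: 'c::comm_semiring_1)) ks)
      (1\<^sub>m N) $$ (a, b) =
    of_nat (card {xs \<in> walks N R ks. hd xs = a \<and> last xs = b})"
  using assms
proof (induction ks arbitrary: a)
  case Nil
  have "{xs \<in> walks N R []. hd xs = a \<and> last xs = b} = (if a = b then {[a]} else {})"
    using Nil by (auto simp: walks_def length_Suc_conv)
  then show ?case using Nil by simp
next
  case (Cons k ks)
  define P where "P = foldr (*) (map (\<lambda>k. mat N N (\<lambda>(i, j). of_bool (R k i j) :: 'c)) ks) (1\<^sub>m N)"
  define W where "W x = {xs \<in> walks N R ks. hd xs = x \<and> last xs = b}" for x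
  have P: "P \<in> carrier_mat N N"
    unfolding P_def by (rule foldr_mult_carrier_mat) auto
  have finW: "finite (W x)" for x
    unfolding W_def using finite_walks by (rule rev_finite_subset) auto
  \<comment> \<open>Sort the walks by their second vertex \<open>x\<close>; the remaining walk then
    starts at \<open>x\<close>, which makes the sets \<open>W x\<close> disjoint.\<close>
  have split: "{xs \<in> walks N R (k # ks). hd xs = a \<and> last xs = b} =
      (#) a ` (\<Union>x\<in>{x. x < N \<and> R k a x}. W x)" (is "?L = ?R")
  proof (intro equalityI subsetI)
    fix ys assume "ys \<in> ?L"
    then obtain xs where ys: "ys = a # xs" "a # xs \<in> walks N R (k # ks)" "last ys = b"
      by (cases ys) (auto simp: walks_def)
    then have xs: "xs \<in> walks N R ks" "R k a (xs ! 0)"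
      by (auto simp: walks_Cons_iff)
    then have "xs \<noteq> []" "xs ! 0 < N" by (auto simp: walks_def subset_iff)
    then have "xs \<in> W (xs ! 0)" using xs ys by (auto simp: W_def hd_conv_nth)
    then show "ys \<in> ?R" using xs ys \<open>xs ! 0 < N\<close> by auto
  next
    fix ys assume "ys \<in> ?R"
    then obtain xs x where xs: "ys = a # xs" "x < N" "R k a x" "xs \<in> W x" by auto
    moreover from xs have "xs \<noteq> []" by (auto simp: W_def walks_def)
    ultimately show "ys \<in> ?L" using Cons.prems by (auto simp: W_def walks_Cons_iff hd_conv_nth)
  qed
  have "card {xs \<in> walks N R (k # ks). hd xs = a \<and> last xs = b} =
      card (\<Union>x\<in>{x. x < N \<and> R k a x}. W x)"
    unfolding split by (rule card_image) auto
  also have "\<dots> = (\<Sum>x\<in>{x. x < N \<and> R k a x}. card (W x))"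
    by (rule card_UN_disjoint) (use finW in \<open>auto simp: W_def\<close>)
  also have "\<dots> = (\<Sum>x<N. of_bool (R k a x) * card (W x))"
    by (rule sum.mono_neutral_cong_left) auto
  finally have card: "(of_nat (card {xs \<in> walks N R (k # ks). hd xs = a \<and> last xs = b}) :: 'c) =
      (\<Sum>x<N. of_bool (R k a x) * of_nat (card (W x)))" by simp
  have "(mat N N (\<lambda>(i, j). of_bool (R k i j) :: 'c) * P) $$ (a, b) =
      (\<Sum>x<N. of_bool (R k a x) * P $$ (x, b))"
    using Cons.prems P by (auto simp: scalar_prod_def atLeast0LessThan intro!: sum.cong)
  also have "\<dots> = (\<Sum>x<N. of_bool (R k a x) * of_nat (card (W x)))"
    by (intro sum.cong) (use Cons in \<open>auto simp: P_def W_def\<close>)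
  finally show ?case using card by (simp add: P_def)
qed

lemma mat_trace_eq_card_closed_walks:
  "mat_trace (foldr (*) (map (\<lambda>k. mat N N (\<lambda>(i, j). of_bool (R k i j) :: 'c::comm_semiring_1)) ks)
      (1\<^sub>m N)) =
    of_nat (card {xs \<in> walks N R ks. hd xs = last xs})" (is "mat_trace ?P = _")
proof -
  have "?P \<in> carrier_mat N N"
    by (rule foldr_mult_carrier_mat) auto
  then have "mat_trace ?P = (\<Sum>a<N. ?P $$ (a, a))"
    by (simp add: mat_trace_def)
  also have "\<dots> = (\<Sum>a<N. of_nat (card {xs \<in> walks N R ks. hd xs = a \<and> last xs = a}))"
    by (intro sum.cong) (auto simp: foldr_mult_index_eq_card_walks)
  also have "\<dots> = of_nat (card (\<Union>a<N. {xs \<in> walks N R ks. hd xs = a \<and> last xs = a}))"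
    by (subst card_UN_disjoint) (auto simp: finite_walks)
  also have "(\<Union>a<N. {xs \<in> walks N R ks. hd xs = a \<and> last xs = a}) =
      {xs \<in> walks N R ks. hd xs = last xs}"
  proof -
    have "last xs < N" if "xs \<in> walks N R ks" for xs
    proof -
      have "xs \<noteq> []" using that by (auto simp: walks_def)
      then show ?thesis using that last_in_set[of xs] by (auto simp: walks_def simp del: last_in_set)
    qed
    then show ?thesis by auto
  qed
  finally show ?thesis .
qed

section \<open>States of a rung and transfer matrices\<close>

text \<open>The fields say which edges at the rung lie in the matching: the rung itself, and at its ends
  \<open>v\<close> and \<open>u\<close> the edge of the previous and the edge of the next hexagon.\<close>

datatype rung = Rung (on_rung: bool) (v_prev: bool) (v_next: bool) (u_prev: bool) (u_next: bool)

definition v_cov :: "rung \<Rightarrow> bool" where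
  "v_cov r \<longleftrightarrow> on_rung r \<or> v_prev r \<or> v_next r"

definition u_cov :: "rung \<Rightarrow> bool" where
  "u_cov r \<longleftrightarrow> on_rung r \<or> u_prev r \<or> u_next r"

text \<open>The last conjunct is maximality at the rung edge; the others are the matching condition
  at its two ends. \<open>hex_ok\<close> therefore leaves both out.\<close>

definition rung_ok :: "rung \<Rightarrow> bool" where
  "rung_ok r \<longleftrightarrow> \<not> (on_rung r \<and> v_prev r) \<and> \<not> (on_rung r \<and> v_next r) \<and> \<not> (v_prev r \<and> v_next r) \<and>
     \<not> (on_rung r \<and> u_prev r) \<and> \<not> (on_rung r \<and> u_next r) \<and> \<not> (u_prev r \<and> u_next r) \<and>
     (v_cov r \<or> u_cov r)"

text \<open>The order fixes which state each row and column index of the transfer matrices stands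
  for.\<close>

definition rungs :: "rung list" where
  "rungs =
    [Rung True False False False False,
     Rung False True False True False,
     Rung False True False False True,
     Rung False True False False False,
     Rung False False True True False,
     Rung False False True False True,
     Rung False False True False False,
     Rung False False False True False,
     Rung False False False False True]"

lemma length_rungs: "length rungs = 9"
  by (simp add: rungs_def)

lemma distinct_rungs: "distinct rungs"
  by (simp add: rungs_def)

lemma set_rungs: "set rungs = {r. rung_ok r}"
proof -
  have "r \<in> set rungs \<longleftrightarrow> rung_ok r" for r
    by (cases r) (simp add: rungs_def rung_ok_def v_cov_def u_cov_def, argo)
  then show ?thesis by auto
qed

text \<open>Below, \<open>y j\<close> says whether the \<open>j\<close>-th edge of a hexagon of type \<open>t(k)\<close> is in the matching.
  Clockwise, the edges and vertices are numbered so that edge \<open>j\<close> joins vertices \<open>j\<close> and \<open>j + 1\<close>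
  (vertex 6 being vertex 0), edge 0 is the first rung \<open>s\<close>, with \<open>u\<close> = vertex 0 and \<open>v\<close> = vertex 1,
  and edge \<open>k + 1\<close> is the second rung \<open>t\<close>, with \<open>v\<close> = vertex \<open>k + 1\<close> and \<open>u\<close> = vertex \<open>k + 2\<close>.\<close>

definition hex_cov :: "nat \<Rightarrow> (nat \<Rightarrow> bool) \<Rightarrow> rung \<Rightarrow> rung \<Rightarrow> nat \<Rightarrow> bool" where
  "hex_cov k y s t j \<longleftrightarrow>
     (if j = 1 then v_cov s else if j = k + 1 then v_cov t
      else if j = k + 2 then u_cov t else if j = 6 then u_cov s
      else y (j - 1) \<or> y j)"

text \<open>The conditions not already in \<open>rung_ok\<close>: the matching condition at vertices
  off both rungs, and domination of the edges that are not rungs. Coverage of a rung end also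
  depends on the neighbouring hexagon, hence is read from the state.\<close>

definition hex_ok :: "nat \<Rightarrow> (nat \<Rightarrow> bool) \<Rightarrow> rung \<Rightarrow> rung \<Rightarrow> bool" where
  "hex_ok k y s t \<longleftrightarrow>
     (\<forall>j\<in>{2,3,4,5}. j \<noteq> k + 1 \<and> j \<noteq> k + 2 \<longrightarrow> \<not> (y (j - 1) \<and> y j)) \<and>
     (\<forall>j\<in>{1,2,3,4,5}. j \<noteq> k + 1 \<longrightarrow> hex_cov k y s t j \<or> hex_cov k y s t (Suc j))"

text \<open>For \<open>k = 1\<close> edge 1 touches both rungs, and for \<open>k = 3\<close> edge 5
  does, so this also makes the two states agree on that edge.\<close>

definition hex_interface :: "nat \<Rightarrow> (nat \<Rightarrow> bool) \<Rightarrow> rung \<Rightarrow> rung \<Rightarrow> bool" where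
  "hex_interface k y s t \<longleftrightarrow>
     y 0 = on_rung s \<and> y 1 = v_next s \<and> y 5 = u_next s \<and>
     y (k + 1) = on_rung t \<and> y k = v_prev t \<and> y (k + 2) = u_prev t"

text \<open>The last two cases concern the middle edge of a side of length 3 (edge 2 if \<open>k = 3\<close>, edge 4
  if \<open>k = 1\<close>).\<close>

definition hex_fill :: "nat \<Rightarrow> rung \<Rightarrow> rung \<Rightarrow> nat \<Rightarrow> bool" where
  "hex_fill k s t j \<longleftrightarrow>
     (if j = 0 then on_rung s else if j = 1 then v_next s else if j = 5 then u_next s
      else if j = k then v_prev t else if j = k + 1 then on_rung t else if j = k + 2 then u_prev t
      else if j = 2 then \<not> v_next s \<and> \<not> v_prev t
      else \<not> u_next s \<and> \<not> u_prev t)"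

text \<open>Existence of a filling is tested on its only candidate \<open>hex_fill\<close>, so that
  each matrix entry can be evaluated.\<close>

definition hex_step :: "attachment \<Rightarrow> rung \<Rightarrow> rung \<Rightarrow> bool" where
  "hex_step m s t \<longleftrightarrow> (let k = attachment_size m; y = hex_fill k s t in
     hex_interface k y s t \<and> hex_ok k y s t)"

lemma hex_fill_unique:
  assumes "k = attachment_size m" "hex_interface k y s t" "hex_ok k y s t" "j < 6"
  shows "y j = hex_fill k s t j"
proof -
  have j: "j = 0 \<or> j = 1 \<or> j = 2 \<or> j = 3 \<or> j = 4 \<or> j = 5"
    using assms(4) by linarith
  show ?thesis
  proof (cases m)
    case Left_Angular
    then have k: "k = 1" using assms(1) by simp
    \<comment> \<open>Vertices 4 and 5 forbid edge 4 next to a chosen neighbour; domination of edge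
      4 forces it otherwise. For \<open>k = 3\<close> the same happens at edge 2, while for
      \<open>k = 2\<close> the rungs determine all six edges.\<close>
    have "y 4 \<longleftrightarrow> \<not> y 5 \<and> \<not> y 3"
      using assms(3) unfolding hex_ok_def hex_cov_def k by auto
    then show ?thesis
      using j assms(2) unfolding k hex_interface_def hex_fill_def
      by (elim disjE) (simp_all add: eval_nat_numeral)
  next
    case Linear
    then have k: "k = 2" using assms(1) by simp
    show ?thesis
      using j assms(2) unfolding k hex_interface_def hex_fill_def by (elim disjE) simp_all
  next
    case Right_Angular
    then have k: "k = 3" using assms(1) by simp
    have "y 2 \<longleftrightarrow> \<not> y 1 \<and> \<not> y 3"
      using assms(3) unfolding hex_ok_def hex_cov_def k by auto
    then show ?thesis
      using j assms(2) unfolding k hex_interface_def hex_fill_def by (elim disjE) simp_all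
  qed
qed

lemma hex_ok_cong:
  assumes "\<And>j. j < 6 \<Longrightarrow> y j = y' j"
  shows "hex_ok k y s t = hex_ok k y' s t"
proof -
  have cov: "hex_cov k y s t j = hex_cov k y' s t j" if "j \<le> 6" for j
    using that assms[of j] assms[of "j - 1"] by (auto simp: hex_cov_def)
  show ?thesis
    unfolding hex_ok_def using assms by (simp add: cov)
qed

lemma hex_interface_cong:
  assumes "\<And>j. j < 6 \<Longrightarrow> y j = y' j" "k < 4"
  shows "hex_interface k y s t = hex_interface k y' s t"
  unfolding hex_interface_def using assms by simp

lemma attachment_size_bounds: "1 \<le> attachment_size m" "attachment_size m < 4"
  by (cases m; simp)+

lemma hex_step_if_hex_ok:
  assumes "hex_interface (attachment_size m) y s t" "hex_ok (attachment_size m) y s t"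
  shows "hex_step m s t"
proof -
  let ?k = "attachment_size m"
  have "y j = hex_fill ?k s t j" if "j < 6" for j
    using hex_fill_unique[OF refl assms that] .
  note hex_ok_cong[OF this] hex_interface_cong[OF this attachment_size_bounds(2)]
  then show ?thesis
    using assms unfolding hex_step_def Let_def by simp
qed

text \<open>\<open>split_left\<close> is \<open>U\<close> and \<open>split_right\<close> is \<open>V\<close>. The matrix \<open>U\<close> spans the
  one-dimensional space of solutions of \<open>f(M) U = U A(M)\<close> for all three \<open>M\<close>; it has
  rank 8. Solving \<open>f(M) = U V(M)\<close> and \<open>A(M) = V(M) U\<close> gives \<open>V(M)\<close>, whose rows are rows of
  \<open>f(M)\<close> or differences of two rows of \<open>f(M)\<close>.\<close>

definition split_left_rows :: "int list list" where
  "split_left_rows =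
    [[1,0,0,0,0,1,1,0,1],
     [0,0,1,1,0,0,0,0,0],
     [0,0,0,0,1,0,0,1,0],
     [0,1,0,0,0,0,0,0,0],
     [1,0,0,0,0,1,0,0,0],
     [0,0,1,0,0,0,0,0,0],
     [0,0,0,0,1,0,0,0,0],
     [1,0,0,0,0,1,1,0,0],
     [1,0,0,0,0,1,0,0,1]]"

fun split_right_rows :: "attachment \<Rightarrow> int list list" where
  "split_right_rows Linear =
    [[0,0,0,1,1,1,1,0,0],
     [0,0,0,1,1,1,1,0,0],
     [0,1,0,0,0,0,0,1,0],
     [0,0,0,1,0,0,1,0,0],
     [0,0,1,0,0,0,0,0,1],
     [1,0,0,0,0,0,0,0,0],
     [0,0,1,0,0,0,0,0,0],
     [0,0,0,1,0,1,0,0,0],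
     [0,1,0,0,0,0,0,0,0]]"
| "split_right_rows Left_Angular =
    [[1,0,1,0,0,0,0,0,0],
     [1,0,1,0,0,0,0,0,0],
     [0,0,1,0,0,0,0,0,1],
     [1,0,0,0,0,0,0,0,0],
     [0,1,0,1,0,0,0,0,0],
     [0,0,0,1,0,1,0,0,0],
     [0,1,0,0,0,0,0,0,0],
     [0,0,0,0,0,0,1,1,0],
     [0,0,0,0,1,0,1,0,0]]"
| "split_right_rows Right_Angular =
    [[1,1,0,0,0,0,0,0,0],
     [1,1,0,0,0,0,0,0,0],
     [0,0,1,1,0,0,0,0,0],
     [0,0,0,0,0,1,0,0,1],
     [0,1,0,0,0,0,0,1,0],
     [0,0,0,1,0,0,1,0,0],
     [0,0,0,0,1,1,0,0,0],
     [1,0,0,0,0,0,0,0,0],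
     [0,0,1,0,0,0,0,0,0]]"

definition split_left :: "int mat" where
  "split_left = mat_of_rows_list 9 split_left_rows"

definition split_right :: "attachment \<Rightarrow> int mat" where
  "split_right m = mat_of_rows_list 9 (split_right_rows m)"

lemma split_rows_shape:
  "length split_left_rows = 9 \<and> list_all (\<lambda>r. length r = 9) split_left_rows"
  "length (split_right_rows m) = 9 \<and> list_all (\<lambda>r. length r = 9) (split_right_rows m)"
proof -
  show "length split_left_rows = 9 \<and> list_all (\<lambda>r. length r = 9) split_left_rows"
    by (simp add: split_left_rows_def)
  show "length (split_right_rows m) = 9 \<and> list_all (\<lambda>r. length r = 9) (split_right_rows m)"
    by (cases m) simp_all
qed

lemma split_carrier: "split_left \<in> carrier_mat 9 9" "split_right m \<in> carrier_mat 9 9"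
  using split_rows_shape unfolding split_left_def split_right_def
  by (auto simp: mat_of_rows_list_def)

text \<open>A row of a product is a combination of the rows of the right factor. The recursion on
  lists lets the simplifier evaluate concrete products.\<close>

fun row_comb :: "nat \<Rightarrow> 'a::semiring_0 list \<Rightarrow> 'a list list \<Rightarrow> 'a list" where
  "row_comb N (c # cs) (r # rs) = map2 (\<lambda>x y. c * x + y) r (row_comb N cs rs)"
| "row_comb N cs rs = replicate N 0"

lemma row_comb_nth:
  assumes "length cs = length rs" "\<And>r. r \<in> set rs \<Longrightarrow> length r = N"
  shows "length (row_comb N cs rs) = N \<and>
    (\<forall>j<N. row_comb N cs rs ! j = (\<Sum>l<length rs. cs ! l * rs ! l ! j))"
  using assms
proof (induction N cs rs rule: row_comb.induct)
  case (1 N c cs r rs)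
  then show ?case by (simp add: sum.lessThan_Suc_shift del: sum.lessThan_Suc)
qed auto

lemma mat_of_rows_list_mult:
  assumes "length A = N" "length B = N" "\<And>r. r \<in> set A \<Longrightarrow> length r = N"
    "\<And>r. r \<in> set B \<Longrightarrow> length r = N"
  shows "mat_of_rows_list N A * mat_of_rows_list N B =
    mat_of_rows_list N (map (\<lambda>r. row_comb N r B) A)"
proof (intro eq_matI)
  fix i j
  assume "i < dim_row (mat_of_rows_list N (map (\<lambda>r. row_comb N r B) A))"
    and "j < dim_col (mat_of_rows_list N (map (\<lambda>r. row_comb N r B) A))"
  then have ij: "i < N" "j < N" using assms by (auto simp: mat_of_rows_list_def)
  then show "(mat_of_rows_list N A * mat_of_rows_list N B) $$ (i, j) =
      mat_of_rows_list N (map (\<lambda>r. row_comb N r B) A) $$ (i, j)"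
    using assms row_comb_nth[of "A ! i" B N]
    by (simp add: mat_of_rows_list_def scalar_prod_def atLeast0LessThan)
qed (use assms in \<open>auto simp: mat_of_rows_list_def\<close>)

lemma split_mult:
  "split_left * split_right m =
    mat_of_rows_list 9 (map (\<lambda>r. row_comb 9 r (split_right_rows m)) split_left_rows)"
  "split_right m * split_left =
    mat_of_rows_list 9 (map (\<lambda>r. row_comb 9 r split_left_rows) (split_right_rows m))"
  unfolding split_left_def split_right_def
  by (rule mat_of_rows_list_mult; use split_rows_shape[unfolded list_all_iff] in blast)+

lemma replicate_9: "replicate 9 x = [x, x, x, x, x, x, x, x, x]"
  by (simp add: eval_nat_numeral)

lemma split_rows_mult_L: "mat_L = split_left * split_right Left_Angular"
  unfolding split_mult mat_L_def by (simp add: split_left_rows_def replicate_9)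
lemma split_rows_mult_S: "mat_S = split_left * split_right Linear"
  unfolding split_mult mat_S_def by (simp add: split_left_rows_def replicate_9)
lemma split_rows_mult_R: "mat_R = split_left * split_right Right_Angular"
  unfolding split_mult mat_R_def by (simp add: split_left_rows_def replicate_9)

lemma attachment_mat_split: "attachment_mat m = split_left * split_right m"
  by (cases m) (simp_all only: attachment_mat.simps split_rows_mult_L split_rows_mult_S split_rows_mult_R)

text \<open>A finite check of 81 entries for each of the three attachments. Here the explicit
  matrices meet the combinatorics.\<close>

lemma split_rows_mult_hex_step:
  "map (\<lambda>r. row_comb 9 r split_left_rows) (split_right_rows m) =
    map (\<lambda>s. map (\<lambda>t. of_bool (hex_step m s t)) rungs) rungs"
  by (cases m)
    (simp_all add: split_left_rows_def rungs_def replicate_9 hex_step_def hex_fill_def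
      hex_interface_def hex_ok_def hex_cov_def v_cov_def u_cov_def)

lemma split_right_mult_split_left:
  "split_right m * split_left = mat 9 9 (\<lambda>(i, j). of_bool (hex_step m (rungs ! i) (rungs ! j)))"
  unfolding split_mult split_rows_mult_hex_step
  by (intro eq_matI) (auto simp: mat_of_rows_list_def length_rungs)

lemma mat_trace_attachments:
  assumes "ms \<noteq> []"
  shows "mat_trace (foldr (*) (map attachment_mat ms) (1\<^sub>m 9)) =
    int (card {xs \<in> walks 9 (\<lambda>m i j. hex_step m (rungs ! i) (rungs ! j)) ms. hd xs = last xs})"
proof -
  have "mat_trace (foldr (*) (map attachment_mat ms) (1\<^sub>m 9)) =
      mat_trace (foldr (*) (map (\<lambda>m. split_left * split_right m) ms) (1\<^sub>m 9))"
    by (simp add: attachment_mat_split[abs_def])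
  also have "\<dots> = mat_trace (foldr (*) (map (\<lambda>m. split_right m * split_left) ms) (1\<^sub>m 9))"
    using split_carrier assms by (intro mat_trace_foldr_mult_rotate) auto
  finally show ?thesis
    by (simp only: split_right_mult_split_left mat_trace_eq_card_closed_walks)
qed

section \<open>Maximal matchings of a cycle of hexagons\<close>

text \<open>\<open>w i j\<close> is vertex \<open>j\<close> of hexagon \<open>i\<close> in the numbering used above.\<close>

locale hexagon_cycle =
  fixes E :: "'a set set" and n :: nat and w :: "nat \<Rightarrow> nat \<Rightarrow> 'a" and ms :: "attachment list"
  assumes n3: "3 \<le> n" and length_ms: "length ms = n"
    and w6: "i < n \<Longrightarrow> w i 6 = w i 0"
    and w_inj: "i < n \<Longrightarrow> inj_on (w i) {..<6}"
    and E_eq: "E = {{w i j, w i (Suc j)} | i j. i < n \<and> j < 6}"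
    and glue_v: "i < n \<Longrightarrow> w i (attachment_size (ms ! i) + 1) = w (Suc i mod n) 1"
    and glue_u: "i < n \<Longrightarrow> w i (attachment_size (ms ! i) + 2) = w (Suc i mod n) 0"
    and meet_next: "i < n \<Longrightarrow> j < 6 \<Longrightarrow> j' < 6 \<Longrightarrow> w i j = w (Suc i mod n) j' \<Longrightarrow>
      j = attachment_size (ms ! i) + 1 \<or> j = attachment_size (ms ! i) + 2"
    and apart: "i < n \<Longrightarrow> i' < n \<Longrightarrow> i \<noteq> i' \<Longrightarrow> i' \<noteq> Suc i mod n \<Longrightarrow> i \<noteq> Suc i' mod n \<Longrightarrow>
      j < 6 \<Longrightarrow> j' < 6 \<Longrightarrow> w i j \<noteq> w i' j'"
begin

section \<open>Incidences of vertices and edges in the cycle of hexagons\<close>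

definition nx :: "nat \<Rightarrow> nat" where "nx i = Suc i mod n"
definition pr :: "nat \<Rightarrow> nat" where "pr i = (if i = 0 then n - 1 else i - 1)"
definition k :: "nat \<Rightarrow> nat" where "k i = attachment_size (ms ! i)"
definition edge :: "nat \<Rightarrow> nat \<Rightarrow> 'a set" where "edge i j = {w i j, w i (Suc j)}"

lemma nx_eq: "i < n \<Longrightarrow> nx i = (if Suc i = n then 0 else Suc i)"
  by (auto simp: nx_def)

lemma nx_less: "i < n \<Longrightarrow> nx i < n"
  by (auto simp: nx_def)

lemma pr_less: "i < n \<Longrightarrow> pr i < n"
  by (auto simp: pr_def)

lemma pr_nx: "i < n \<Longrightarrow> pr (nx i) = i"
  by (auto simp: nx_eq pr_def)

lemma nx_pr: "i < n \<Longrightarrow> nx (pr i) = i"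
  by (auto simp: nx_eq pr_def)

lemma k_bounds: "1 \<le> k i" "k i \<le> 3"
  using attachment_size_bounds[of "ms ! i"] by (auto simp: k_def)

lemma w_eq_iff: "i < n \<Longrightarrow> a < 6 \<Longrightarrow> b < 6 \<Longrightarrow> w i a = w i b \<longleftrightarrow> a = b"
  using w_inj[of i] by (auto simp: inj_on_def)

lemma w_Suc: "i < n \<Longrightarrow> j < 6 \<Longrightarrow> w i (Suc j) = w i (Suc j mod 6)"
  using w6[of i] by (cases "j = 5") auto

lemma glue: "i < n \<Longrightarrow> w i (Suc (k i)) = w (nx i) 1" "i < n \<Longrightarrow> w i (Suc (Suc (k i))) = w (nx i) 0"
  using glue_v[of i] glue_u[of i] by (auto simp: k_def nx_def)

lemma meet_nextD:
  "i < n \<Longrightarrow> j < 6 \<Longrightarrow> j' < 6 \<Longrightarrow> w i j = w (nx i) j' \<Longrightarrow> j = Suc (k i) \<or> j = Suc (Suc (k i))"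
  using meet_next[of i j j'] by (auto simp: k_def nx_def)

lemma apartD:
  "w i j = w i' j' \<Longrightarrow> i < n \<Longrightarrow> i' < n \<Longrightarrow> j < 6 \<Longrightarrow> j' < 6 \<Longrightarrow> i = i' \<or> i' = nx i \<or> i = nx i'"
  using apart[of i i' j j'] by (auto simp: nx_def)

lemma nx_inject: "i < n \<Longrightarrow> i' < n \<Longrightarrow> nx i = nx i' \<Longrightarrow> i = i'"
  using pr_nx by metis

lemma apart_nxD:
  assumes "w (nx i) j = w i' j'" "i < n" "i' < n" "j < 6" "j' < 6"
  shows "i' = nx i \<or> i' = i \<or> i' = nx (nx i)"
  using apartD[OF assms(1) nx_less[OF assms(2)] assms(3-5)] nx_inject[OF assms(2,3)] by metis

text \<open>\<open>(a + 5) mod 6\<close> is the cyclic predecessor of \<open>a\<close>, free of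
  truncated subtraction.\<close>

lemma mem_edgeE:
  assumes "v \<in> edge i j" "i < n" "j < 6"
  obtains a where "a < 6" "v = w i a" "j = a \<or> j = (a + 5) mod 6"
proof -
  consider "v = w i j" | "v = w i (Suc j mod 6)"
    using assms w_Suc by (auto simp: edge_def)
  then show thesis
  proof cases
    case 1
    then show thesis using that[of j] assms by auto
  next
    case 2
    have "j = (Suc j mod 6 + 5) mod 6" using assms(3) by presburger
    then show thesis using that[of "Suc j mod 6"] 2 by auto
  qed
qed

lemma edge_in_E: "i < n \<Longrightarrow> j < 6 \<Longrightarrow> edge i j \<in> E"
  by (auto simp: E_eq edge_def)

lemma E_E: assumes "a \<in> E" obtains i j where "i < n" "j < 6" "a = edge i j"
  using assms by (auto simp: E_eq edge_def)

lemma edge_glue: "i < n \<Longrightarrow> edge i (Suc (k i)) = edge (nx i) 0"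
  using glue[of i] by (auto simp: edge_def)

lemma edge_eq_same: 
  assumes "i < n" "j < 6" "j' < 6" "edge i j = edge i j'"
  shows "j = j'"
proof -
  have "w i j \<in> edge i j'" "w i (Suc j mod 6) \<in> edge i j'"
    using assms w_Suc[of i j] by (auto simp: edge_def)
  then have "w i j = w i j' \<or> w i j = w i (Suc j' mod 6)"
    "w i (Suc j mod 6) = w i j' \<or> w i (Suc j mod 6) = w i (Suc j' mod 6)"
    using assms w_Suc[of i j'] by (auto simp: edge_def)
  then have "j = j' \<or> j = Suc j' mod 6" "Suc j mod 6 = j' \<or> Suc j mod 6 = Suc j' mod 6"
    using assms by (auto simp: w_eq_iff)
  then show ?thesis using assms(2,3) by presburger
qed

text \<open>Both ends lie in the next hexagon, so both have index \<open>k i + 1\<close> or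
  \<open>k i + 2\<close>; only edge \<open>k i + 1\<close> has such ends. It is edge 0 of the next
  hexagon, where edges are told apart by their index.\<close>

lemma edge_eq_next:
  assumes "i < n" "j < 6" "j' < 6" "edge i j = edge (nx i) j'"
  shows "j = Suc (k i) \<and> j' = 0"
proof -
  have "w i j \<in> edge (nx i) j'" "w i (Suc j mod 6) \<in> edge (nx i) j'"
    using assms w_Suc[of i j] by (auto simp: edge_def)
  then obtain a b where "a < 6" "w i j = w (nx i) a" "b < 6" "w i (Suc j mod 6) = w (nx i) b"
    using assms nx_less by (metis mem_edgeE)
  then have "j = Suc (k i) \<or> j = Suc (Suc (k i))"
    "Suc j mod 6 = Suc (k i) \<or> Suc j mod 6 = Suc (Suc (k i))"
    using assms meet_nextD[of i] by auto
  then have j: "j = Suc (k i)" using assms(2) k_bounds[of i] by presburger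
  then have "edge (nx i) 0 = edge (nx i) j'" using assms edge_glue by simp
  then have "0 = j'" by (rule edge_eq_same[rotated 3]) (use assms nx_less in simp_all)
  then show ?thesis using j by simp
qed

lemma edge_eqD:
  assumes "edge i j = edge i' j'" "i < n" "i' < n" "j < 6" "j' < 6"
  shows "i = i' \<and> j = j' \<or> i' = nx i \<and> j = Suc (k i) \<and> j' = 0 \<or>
    i = nx i' \<and> j' = Suc (k i') \<and> j = 0"
proof -
  have "w i j \<in> edge i' j'" using assms(1) by (auto simp: edge_def)
  then obtain a where "a < 6" "w i j = w i' a" using assms mem_edgeE by metis
  then consider "i = i'" | "i' = nx i" | "i = nx i'" using apartD assms by metis
  then show ?thesis
  proof cases
    case 1
    then show ?thesis using assms edge_eq_same by metis
  next
    case 2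
    then show ?thesis using assms edge_eq_next by metis
  next
    case 3
    then show ?thesis using assms edge_eq_next by metis
  qed
qed

lemma u_mem_edges:
  assumes "i < n"
  shows "w (nx i) 0 \<in> edge (nx i) 0" "w (nx i) 0 \<in> edge i (Suc (Suc (k i)))"
    "w (nx i) 0 \<in> edge (nx i) 5"
  using glue(2)[OF assms] w6[OF nx_less[OF assms]] by (simp_all add: edge_def)

lemma v_mem_edges:
  assumes "i < n"
  shows "w (nx i) 1 \<in> edge (nx i) 0" "w (nx i) 1 \<in> edge i (k i)" "w (nx i) 1 \<in> edge (nx i) 1"
  using glue(1)[OF assms] by (simp_all add: edge_def)

text \<open>A hexagon through this end is \<open>i\<close>, \<open>nx i\<close> or
  \<open>nx (nx i)\<close>, and the last is excluded because index 0 is not on the far rung of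
  \<open>nx i\<close>. Each of the other two contributes two edges, and they share the rung.\<close>

lemma incident_u:
  assumes "i < n"
  shows "{a \<in> E. w (nx i) 0 \<in> a} = {edge (nx i) 0, edge i (Suc (Suc (k i))), edge (nx i) 5}"
proof (intro equalityI subsetI)
  fix a assume "a \<in> {a \<in> E. w (nx i) 0 \<in> a}"
  then obtain i' j' b where a: "a = edge i' j'" "i' < n" "j' < 6"
    and b: "b < 6" "w (nx i) 0 = w i' b" "j' = b \<or> j' = (b + 5) mod 6"
    by (metis (no_types, lifting) mem_Collect_eq E_E mem_edgeE)
  from b(2) consider "i' = nx i" | "i' = i" | "i' = nx (nx i)"
    using apart_nxD[OF b(2) assms a(2) _ b(1)] by fastforce
  then show "a \<in> {edge (nx i) 0, edge i (Suc (Suc (k i))), edge (nx i) 5}"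
  proof cases
    case 1
    then have "b = 0" using w_eq_iff[of "nx i" 0 b] b assms nx_less by auto
    then show ?thesis using a b 1 by auto
  next
    case 2
    then have "b = Suc (Suc (k i))"
      using w_eq_iff[of i "Suc (Suc (k i))" b] b assms glue[of i] k_bounds[of i] by auto
    then have "j' = Suc (Suc (k i)) \<or> j' = Suc (k i)" using b(3) k_bounds[of i] by presburger
    then show ?thesis using a 2 edge_glue assms by auto
  next
    case 3
    then show ?thesis using meet_nextD[of "nx i" 0 b] b assms nx_less by auto
  qed
next
  fix a assume "a \<in> {edge (nx i) 0, edge i (Suc (Suc (k i))), edge (nx i) 5}"
  moreover have "edge (nx i) 0 \<in> E" "edge i (Suc (Suc (k i))) \<in> E" "edge (nx i) 5 \<in> E"
    by (rule edge_in_E; use assms nx_less[OF assms] k_bounds[of i] in simp)+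
  ultimately show "a \<in> {a \<in> E. w (nx i) 0 \<in> a}" using u_mem_edges[OF assms] by blast
qed

lemma incident_v:
  assumes "i < n"
  shows "{a \<in> E. w (nx i) 1 \<in> a} = {edge (nx i) 0, edge i (k i), edge (nx i) 1}"
proof (intro equalityI subsetI)
  fix a assume "a \<in> {a \<in> E. w (nx i) 1 \<in> a}"
  then obtain i' j' b where a: "a = edge i' j'" "i' < n" "j' < 6"
    and b: "b < 6" "w (nx i) 1 = w i' b" "j' = b \<or> j' = (b + 5) mod 6"
    by (metis (no_types, lifting) mem_Collect_eq E_E mem_edgeE)
  from b(2) consider "i' = nx i" | "i' = i" | "i' = nx (nx i)"
    using apart_nxD[OF b(2) assms a(2) _ b(1)] by fastforce
  then show "a \<in> {edge (nx i) 0, edge i (k i), edge (nx i) 1}"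
  proof cases
    case 1
    then have "b = 1" using w_eq_iff[of "nx i" 1 b] b assms nx_less by auto
    then show ?thesis using a b 1 by auto
  next
    case 2
    then have "b = Suc (k i)"
      using w_eq_iff[of i "Suc (k i)" b] b assms glue[of i] k_bounds[of i] by auto
    then have "j' = Suc (k i) \<or> j' = k i" using b(3) k_bounds[of i] by presburger
    then show ?thesis using a 2 edge_glue assms by auto
  next
    case 3
    \<comment> \<open>Index 1 is not on the far rung of \<open>nx i\<close> either, since that rung
      has indices at least 2.\<close>
    then show ?thesis using meet_nextD[of "nx i" 1 b] b assms nx_less k_bounds[of "nx i"] by auto
  qed
next
  fix a assume "a \<in> {edge (nx i) 0, edge i (k i), edge (nx i) 1}"
  moreover have "edge (nx i) 0 \<in> E" "edge i (k i) \<in> E" "edge (nx i) 1 \<in> E"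
    by (rule edge_in_E; use assms nx_less[OF assms] k_bounds[of i] in simp)+
  ultimately show "a \<in> {a \<in> E. w (nx i) 1 \<in> a}" using v_mem_edges[OF assms] by blast
qed

text \<open>Such a vertex lies in one hexagon only: a vertex shared with the next hexagon is on the
  far rung, and one shared with the previous hexagon has index 0 or 1.\<close>

lemma incident_inner:
  assumes "i < n" "2 \<le> j" "j < 6" "j \<noteq> Suc (k i)" "j \<noteq> Suc (Suc (k i))"
  shows "{a \<in> E. w i j \<in> a} = {edge i (j - 1), edge i j}"
proof (intro equalityI subsetI)
  fix a assume "a \<in> {a \<in> E. w i j \<in> a}"
  then obtain i' j' b where a: "a = edge i' j'" "i' < n" "j' < 6"
    and b: "b < 6" "w i j = w i' b" "j' = b \<or> j' = (b + 5) mod 6"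
    by (metis (no_types, lifting) mem_Collect_eq E_E mem_edgeE)
  from b(2) consider "i' = i" | "i' = nx i" | "i = nx i'"
    using apartD[OF b(2) assms(1) a(2) assms(3) b(1)] by metis
  then show "a \<in> {edge i (j - 1), edge i j}"
  proof cases
    case 1
    then have "b = j" using w_eq_iff[of i j b] b assms by auto
    then have "j' = j \<or> j' = j - 1" using b(3) assms(2,3) by presburger
    then show ?thesis using a 1 by auto
  next
    case 2
    then show ?thesis using meet_nextD[of i j b] b assms by auto
  next
    case 3
    then have "b = Suc (k i') \<or> b = Suc (Suc (k i'))"
      using meet_nextD[of i' b j] b a assms by auto
    then have "w i j = w i 1 \<or> w i j = w i 0" using glue[of i'] a b 3 by auto
    then show ?thesis using w_eq_iff[of i j] assms by auto
  qed
next
  fix a assume "a \<in> {edge i (j - 1), edge i j}"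
  then have "a \<in> E" "w i j \<in> a"
    using assms by (auto intro!: edge_in_E) (auto simp: edge_def)
  then show "a \<in> {a \<in> E. w i j \<in> a}" by simp
qed

section \<open>Rung states of a set of edges\<close>

definition rung_of :: "'a set set \<Rightarrow> nat \<Rightarrow> rung" where
  "rung_of M i = Rung (edge i 0 \<in> M) (edge (pr i) (k (pr i)) \<in> M) (edge i 1 \<in> M)
     (edge (pr i) (Suc (Suc (k (pr i)))) \<in> M) (edge i 5 \<in> M)"

lemma covered_iff: "M \<subseteq> E \<Longrightarrow> v \<in> \<Union>M \<longleftrightarrow> {a \<in> E. v \<in> a} \<inter> M \<noteq> {}"
  by auto

lemma covered_u: "M \<subseteq> E \<Longrightarrow> i < n \<Longrightarrow> w i 0 \<in> \<Union>M \<longleftrightarrow> u_cov (rung_of M i)"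
  using incident_u[of "pr i"] pr_less[of i] nx_pr[of i]
  by (simp only: covered_iff) (auto simp: u_cov_def rung_of_def)

lemma covered_v: "M \<subseteq> E \<Longrightarrow> i < n \<Longrightarrow> w i 1 \<in> \<Union>M \<longleftrightarrow> v_cov (rung_of M i)"
  using incident_v[of "pr i"] pr_less[of i] nx_pr[of i]
  by (simp only: covered_iff) (auto simp: v_cov_def rung_of_def)

lemma covered_inner:
  "M \<subseteq> E \<Longrightarrow> i < n \<Longrightarrow> 2 \<le> j \<Longrightarrow> j < 6 \<Longrightarrow> j \<noteq> Suc (k i) \<Longrightarrow> j \<noteq> Suc (Suc (k i)) \<Longrightarrow>
    w i j \<in> \<Union>M \<longleftrightarrow> edge i (j - 1) \<in> M \<or> edge i j \<in> M"
  using incident_inner[of i j] unfolding covered_iff by auto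

text \<open>This justifies \<open>hex_cov\<close>. Index 6 stands for vertex 0, so that both ends of
  edge 5 are in range.\<close>

lemma covered_hex:
  assumes "M \<subseteq> E" "i < n" "1 \<le> j" "j \<le> 6"
  shows "w i j \<in> \<Union>M \<longleftrightarrow> hex_cov (k i) (\<lambda>j. edge i j \<in> M) (rung_of M i) (rung_of M (nx i)) j"
proof -
  consider "j = 1" | "j = 6" | "j = Suc (k i)" | "j = Suc (Suc (k i))"
    | "2 \<le> j" "j < 6" "j \<noteq> Suc (k i)" "j \<noteq> Suc (Suc (k i))"
    using assms by linarith
  then show ?thesis
  proof cases
    case 1
    then show ?thesis using covered_v assms by (simp add: hex_cov_def)
  next
    case 2
    then show ?thesis using covered_u assms w6 k_bounds[of i] by (simp add: hex_cov_def)
  next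
    case 3
    then show ?thesis using covered_v[of M "nx i"] nx_less assms glue k_bounds[of i]
      by (simp add: hex_cov_def)
  next
    case 4
    then show ?thesis using covered_u[of M "nx i"] nx_less assms glue k_bounds[of i]
      by (simp add: hex_cov_def)
  next
    case 5
    then show ?thesis using covered_inner assms by (simp add: hex_cov_def)
  qed
qed

lemma hex_interface_rung_of:
  assumes "i < n"
  shows "hex_interface (k i) (\<lambda>j. edge i j \<in> M) (rung_of M i) (rung_of M (nx i))"
  using assms by (simp add: hex_interface_def rung_of_def pr_nx edge_glue)

text \<open>Rung ends are written with \<open>nx i'\<close>, the form in which
  \<open>incident_u\<close> and \<open>incident_v\<close> apply.\<close>

lemma vertex_cases:
  assumes "i < n" "j \<le> 6"
  obtains i' where "i' < n" "w i j = w (nx i') 0" | i' where "i' < n" "w i j = w (nx i') 1"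
  | "2 \<le> j" "j < 6" "j \<noteq> Suc (k i)" "j \<noteq> Suc (Suc (k i))"
proof -
  consider "j = 0 \<or> j = 6" | "j = 1" | "j = Suc (k i)" | "j = Suc (Suc (k i))"
    | "2 \<le> j" "j < 6" "j \<noteq> Suc (k i)" "j \<noteq> Suc (Suc (k i))"
    using assms by linarith
  then show thesis
  proof cases
    case 1
    then show thesis using that(1)[of "pr i"] assms pr_less nx_pr w6 by auto
  next
    case 2
    then show thesis using that(2)[of "pr i"] assms pr_less nx_pr by auto
  next
    case 3
    then show thesis using that(2)[of i] assms glue by auto
  next
    case 4
    then show thesis using that(1)[of i] assms glue by auto
  next
    case 5
    then show thesis using that(3) by auto
  qed
qed

section \<open>Maximality as a conjunction of local conditions\<close>

definition disjoint_edges :: "'a set set \<Rightarrow> bool" where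
  "disjoint_edges M \<longleftrightarrow> (\<forall>a\<in>M. \<forall>b\<in>M. a \<noteq> b \<longrightarrow> a \<inter> b = {})"

definition dominates_edges :: "'a set set \<Rightarrow> bool" where
  "dominates_edges M \<longleftrightarrow> (\<forall>a\<in>E. a \<inter> \<Union>M \<noteq> {})"

lemma disjoint_edgesD:
  "disjoint_edges M \<Longrightarrow> a \<noteq> b \<Longrightarrow> v \<in> a \<Longrightarrow> v \<in> b \<Longrightarrow> \<not> (a \<in> M \<and> b \<in> M)"
  by (auto simp: disjoint_edges_def)

lemma rung_of_nx:
  "i < n \<Longrightarrow> rung_of M (nx i) = Rung (edge (nx i) 0 \<in> M) (edge i (k i) \<in> M) (edge (nx i) 1 \<in> M)
     (edge i (Suc (Suc (k i))) \<in> M) (edge (nx i) 5 \<in> M)"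
  by (simp add: rung_of_def pr_nx)

lemma edge_neq_same: "i < n \<Longrightarrow> j < 6 \<Longrightarrow> j' < 6 \<Longrightarrow> j \<noteq> j' \<Longrightarrow> edge i j \<noteq> edge i j'"
  using edge_eq_same by blast

lemma edge_neq_next:
  "i < n \<Longrightarrow> j < 6 \<Longrightarrow> j' < 6 \<Longrightarrow> j \<noteq> Suc (k i) \<or> j' \<noteq> 0 \<Longrightarrow> edge i j \<noteq> edge (nx i) j'"
  using edge_eq_next by blast

lemma rung_ok_if_maximal:
  assumes "M \<subseteq> E" "disjoint_edges M" "dominates_edges M" "i < n"
  shows "rung_ok (rung_of M (nx i))"
proof -
  note inc = u_mem_edges[OF assms(4)] v_mem_edges[OF assms(4)]
  \<comment> \<open>The matching condition speaks of distinct edges only, so the three edges at each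
    end are first told apart.\<close>
  have ne: "edge i (Suc (Suc (k i))) \<noteq> edge (nx i) 0" "edge (nx i) 0 \<noteq> edge (nx i) 5"
    "edge i (Suc (Suc (k i))) \<noteq> edge (nx i) 5"
    "edge i (k i) \<noteq> edge (nx i) 0" "edge (nx i) 0 \<noteq> edge (nx i) 1" "edge i (k i) \<noteq> edge (nx i) 1"
    using k_bounds[of i] nx_less[OF assms(4)]
    by (simp_all add: edge_neq_same edge_neq_next[OF assms(4)])
  note ind = disjoint_edgesD[OF assms(2)]
  have "edge (nx i) 0 \<inter> \<Union>M \<noteq> {}"
    using assms edge_in_E nx_less by (auto simp: dominates_edges_def)
  then have "w (nx i) 0 \<in> \<Union>M \<or> w (nx i) 1 \<in> \<Union>M" by (auto simp: edge_def)
  then have "u_cov (rung_of M (nx i)) \<or> v_cov (rung_of M (nx i))"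
    using covered_u covered_v assms nx_less by metis
  then show ?thesis
    using ind[OF ne(1) inc(2,1)] ind[OF ne(2) inc(1,3)] ind[OF ne(3) inc(2,3)]
      ind[OF ne(4) inc(5,4)] ind[OF ne(5) inc(4,6)] ind[OF ne(6) inc(5,6)]
    unfolding rung_ok_def rung_of_nx[OF assms(4)] by auto
qed

lemma hex_ok_if_maximal:
  assumes "M \<subseteq> E" "disjoint_edges M" "dominates_edges M" "i < n"
  shows "hex_ok (k i) (\<lambda>j. edge i j \<in> M) (rung_of M i) (rung_of M (nx i))"
  unfolding hex_ok_def
proof (intro conjI ballI impI)
  fix j :: nat assume j: "j \<in> {2,3,4,5}" "j \<noteq> k i + 1 \<and> j \<noteq> k i + 2"
  then have bounds: "2 \<le> j" "j < 6" "j - 1 < 6" by auto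
  have "edge i (j - 1) \<noteq> edge i j"
    using edge_eq_same[OF assms(4) bounds(3,2)] bounds by auto
  moreover have "w i j \<in> edge i (j - 1)" "w i j \<in> edge i j"
    using bounds by (auto simp: edge_def)
  ultimately show "\<not> (edge i (j - 1) \<in> M \<and> edge i j \<in> M)"
    by (rule disjoint_edgesD[OF assms(2)])
next
  fix j :: nat assume "j \<in> {1,2,3,4,5}" "j \<noteq> k i + 1"
  then have bounds: "1 \<le> j" "j < 6" "1 \<le> Suc j" "j \<le> 6" "Suc j \<le> 6" by auto
  have "edge i j \<inter> \<Union>M \<noteq> {}"
    using assms(3) edge_in_E[OF assms(4) bounds(2)] by (auto simp: dominates_edges_def)
  then have "w i j \<in> \<Union>M \<or> w i (Suc j) \<in> \<Union>M" by (auto simp: edge_def)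
  then show "hex_cov (k i) (\<lambda>j. edge i j \<in> M) (rung_of M i) (rung_of M (nx i)) j \<or>
      hex_cov (k i) (\<lambda>j. edge i j \<in> M) (rung_of M i) (rung_of M (nx i)) (Suc j)"
    using covered_hex[OF assms(1,4)] bounds by metis
qed

text \<open>Two intersecting edges meet in a vertex: a rung end is controlled by
  \<open>rung_ok\<close>, any other vertex by \<open>hex_ok\<close>.\<close>

lemma disjoint_edges_if_local:
  assumes "M \<subseteq> E"
    and rung: "\<And>i. i < n \<Longrightarrow> rung_ok (rung_of M i)"
    and hex: "\<And>i. i < n \<Longrightarrow> hex_ok (k i) (\<lambda>j. edge i j \<in> M) (rung_of M i) (rung_of M (nx i))"
  shows "disjoint_edges M"
  unfolding disjoint_edges_def
proof (intro ballI impI, rule ccontr)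
  fix a b assume ab: "a \<in> M" "b \<in> M" "a \<noteq> b" "a \<inter> b \<noteq> {}"
  then obtain v where v: "v \<in> a" "v \<in> b" by auto
  from ab assms(1) obtain i j where ij: "i < n" "j < 6" "a = edge i j" by (metis E_E subsetD)
  with v(1) obtain l where l: "l < 6" "v = w i l" by (metis mem_edgeE)
  have mem: "a \<in> {a \<in> E. w i l \<in> a}" "b \<in> {a \<in> E. w i l \<in> a}" using ab v l assms(1) by auto
  have "l \<le> 6" using l by simp
  from ij(1) this show False
  proof (cases rule: vertex_cases)
    case (1 i')
    have "rung_ok (rung_of M (nx i'))" using rung nx_less 1(1) by blast
    then show False
      using mem ab(1-3) unfolding 1(2) incident_u[OF 1(1)] rung_of_nx[OF 1(1)] rung_ok_def by auto
  next
    case (2 i')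
    have "rung_ok (rung_of M (nx i'))" using rung nx_less 2(1) by blast
    then show False
      using mem ab(1-3) unfolding 2(2) incident_v[OF 2(1)] rung_of_nx[OF 2(1)] rung_ok_def by auto
  next
    case 3
    then have "l \<in> {2,3,4,5}" "l \<noteq> k i + 1 \<and> l \<noteq> k i + 2" by auto
    then have "\<not> (edge i (l - 1) \<in> M \<and> edge i l \<in> M)"
      using hex[OF ij(1)] unfolding hex_ok_def by blast
    then show False
      using mem ab(1-3) unfolding incident_inner[OF ij(1) 3] by auto
  qed
qed

text \<open>Edges 0 and \<open>k i + 1\<close> are rungs, dominated because \<open>rung_ok\<close>
  covers one of their ends; \<open>hex_ok\<close> takes care of the others.\<close>

lemma dominates_edges_if_local:
  assumes "M \<subseteq> E"
    and rung: "\<And>i. i < n \<Longrightarrow> rung_ok (rung_of M i)"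
    and hex: "\<And>i. i < n \<Longrightarrow> hex_ok (k i) (\<lambda>j. edge i j \<in> M) (rung_of M i) (rung_of M (nx i))"
  shows "dominates_edges M"
  unfolding dominates_edges_def
proof
  have rung0: "w i 0 \<in> \<Union>M \<or> w i 1 \<in> \<Union>M" if "i < n" for i
    using covered_u[OF assms(1) that] covered_v[OF assms(1) that] rung[OF that]
    by (auto simp: rung_ok_def)
  fix a assume "a \<in> E"
  then obtain i j where ij: "i < n" "j < 6" "a = edge i j" by (rule E_E)
  consider "j = 0" | "j = Suc (k i)" | "j \<in> {1,2,3,4,5}" "j \<noteq> k i + 1"
    using ij(2) by fastforce
  then show "a \<inter> \<Union>M \<noteq> {}"
  proof cases
    case 1
    then show ?thesis using rung0[OF ij(1)] ij by (auto simp: edge_def)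
  next
    case 2
    then have "a = edge (nx i) 0" using ij edge_glue by simp
    then show ?thesis using rung0[OF nx_less[OF ij(1)]] by (auto simp: edge_def)
  next
    case 3
    then have "hex_cov (k i) (\<lambda>j. edge i j \<in> M) (rung_of M i) (rung_of M (nx i)) j \<or>
      hex_cov (k i) (\<lambda>j. edge i j \<in> M) (rung_of M i) (rung_of M (nx i)) (Suc j)"
      using hex[OF ij(1)] unfolding hex_ok_def by blast
    moreover have "1 \<le> j" "j \<le> 6" "1 \<le> Suc j" "Suc j \<le> 6" using 3 by auto
    ultimately have "w i j \<in> \<Union>M \<or> w i (Suc j) \<in> \<Union>M"
      using covered_hex[OF assms(1) ij(1)] by metis
    then show ?thesis using ij by (auto simp: edge_def)
  qed
qed

section \<open>Maximal matchings correspond to closed walks of states\<close>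

definition closed_rung_walks :: "nat list set" where
  "closed_rung_walks = {xs \<in> walks 9 (\<lambda>m i j. hex_step m (rungs ! i) (rungs ! j)) ms. hd xs = last xs}"

definition edges_of_walk :: "nat list \<Rightarrow> 'a set set" where
  "edges_of_walk xs =
    {edge i j | i j. i < n \<and> j < 6 \<and> hex_fill (k i) (rungs ! (xs ! i)) (rungs ! (xs ! nx i)) j}"

lemma closed_rung_walksD:
  assumes "xs \<in> closed_rung_walks"
  shows "length xs = Suc n" "\<And>i. i \<le> n \<Longrightarrow> xs ! i < 9" "\<And>i. i < n \<Longrightarrow> xs ! Suc i = xs ! nx i"
    "\<And>i. i < n \<Longrightarrow> hex_step (ms ! i) (rungs ! (xs ! i)) (rungs ! (xs ! nx i))"
proof -
  show len: "length xs = Suc n" using assms length_ms by (simp add: closed_rung_walks_def walks_def)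
  show "xs ! i < 9" if "i \<le> n" for i
  proof -
    have "xs ! i \<in> set xs" using len that by simp
    moreover have "set xs \<subseteq> {..<9}" using assms by (simp add: closed_rung_walks_def walks_def)
    ultimately show ?thesis by blast
  qed
  have "xs ! n = xs ! 0"
    using assms len hd_conv_nth[of xs] last_conv_nth[of xs]
    by (cases xs) (auto simp: closed_rung_walks_def)
  then show eq: "xs ! Suc i = xs ! nx i" if "i < n" for i
    using that by (auto simp: nx_eq)
  show "hex_step (ms ! i) (rungs ! (xs ! i)) (rungs ! (xs ! nx i))" if "i < n" for i
    using assms that length_ms eq[OF that] by (auto simp: closed_rung_walks_def walks_def)
qed

text \<open>A rung has two names, edge \<open>k i + 1\<close> of hexagon \<open>i\<close> and edge 0
  of \<open>nx i\<close>. The interface condition makes the fillings of both hexagons agree on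
  it.\<close>

lemma edge_mem_edges_of_walk:
  assumes xs: "xs \<in> closed_rung_walks" and "i < n" "j < 6"
  shows "edge i j \<in> edges_of_walk xs \<longleftrightarrow>
    hex_fill (k i) (rungs ! (xs ! i)) (rungs ! (xs ! nx i)) j" (is "_ \<longleftrightarrow> ?fill i j")
proof
  assume "?fill i j"
  then show "edge i j \<in> edges_of_walk xs"
    using assms(2,3) unfolding edges_of_walk_def by blast
next
  assume "edge i j \<in> edges_of_walk xs"
  then obtain i' j' where eq: "edge i j = edge i' j'" and ij': "i' < n" "j' < 6" and f: "?fill i' j'"
    unfolding edges_of_walk_def by blast
  have fill: "?fill l (Suc (k l)) = ?fill (nx l) 0" if "l < n" for l
    using closed_rung_walksD(4)[OF xs that] unfolding hex_step_def Let_def hex_interface_def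
    by (simp add: k_def hex_fill_def)
  from edge_eqD[OF eq assms(2) ij'(1) assms(3) ij'(2)] show "?fill i j"
    using f fill assms(2) ij'(1) by auto
qed

text \<open>The states are recovered from the edges: hexagon \<open>i\<close> gives the rung and its
  next fields, hexagon \<open>pr i\<close> the prev fields. This yields both injectivity and the
  local conditions.\<close>

lemma rung_of_edges_of_walk:
  assumes xs: "xs \<in> closed_rung_walks" and "i < n"
  shows "rung_of (edges_of_walk xs) i = rungs ! (xs ! i)"
proof -
  have p: "pr i < n" "nx (pr i) = i" using assms pr_less nx_pr by auto
  have "hex_interface (k i) (hex_fill (k i) (rungs ! (xs ! i)) (rungs ! (xs ! nx i)))
      (rungs ! (xs ! i)) (rungs ! (xs ! nx i))"
    using closed_rung_walksD(4)[OF xs assms(2)] by (simp add: hex_step_def k_def Let_def)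
  moreover have "hex_interface (k (pr i)) (hex_fill (k (pr i)) (rungs ! (xs ! pr i)) (rungs ! (xs ! i)))
      (rungs ! (xs ! pr i)) (rungs ! (xs ! i))"
    using closed_rung_walksD(4)[OF xs p(1)] p(2) by (simp add: hex_step_def k_def Let_def)
  ultimately show ?thesis
    using assms(2) p k_bounds[of "pr i"]
    by (intro rung.expand) (simp add: rung_of_def edge_mem_edges_of_walk[OF xs] hex_interface_def)
qed

lemma edges_of_walk_maximal:
  assumes xs: "xs \<in> closed_rung_walks"
  shows "edges_of_walk xs \<subseteq> E" "disjoint_edges (edges_of_walk xs)" "dominates_edges (edges_of_walk xs)"
proof -
  let ?M = "edges_of_walk xs"
  show sub: "?M \<subseteq> E" by (auto simp: edges_of_walk_def intro: edge_in_E)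
  have rung: "rung_ok (rung_of ?M i)" if "i < n" for i
  proof -
    have "rungs ! (xs ! i) \<in> set rungs"
      using closed_rung_walksD(2)[OF xs, of i] that by (auto simp: length_rungs)
    then show ?thesis using rung_of_edges_of_walk[OF xs that] set_rungs by auto
  qed
  have hex: "hex_ok (k i) (\<lambda>j. edge i j \<in> ?M) (rung_of ?M i) (rung_of ?M (nx i))" if "i < n" for i
  proof -
    have "hex_ok (k i) (hex_fill (k i) (rungs ! (xs ! i)) (rungs ! (xs ! nx i)))
        (rungs ! (xs ! i)) (rungs ! (xs ! nx i))"
      using closed_rung_walksD(4)[OF xs that] by (simp add: hex_step_def k_def Let_def)
    then show ?thesis
      using edge_mem_edges_of_walk[OF xs that] rung_of_edges_of_walk[OF xs] that nx_less
      by (subst hex_ok_cong[where y' = "hex_fill (k i) (rungs ! (xs ! i)) (rungs ! (xs ! nx i))"]) auto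
  qed
  show "disjoint_edges ?M" by (rule disjoint_edges_if_local[OF sub rung hex])
  show "dominates_edges ?M" by (rule dominates_edges_if_local[OF sub rung hex])
qed

lemma inj_edges_of_walk: "inj_on edges_of_walk closed_rung_walks"
proof
  fix xs ys assume xs: "xs \<in> closed_rung_walks" and ys: "ys \<in> closed_rung_walks"
    and eq: "edges_of_walk xs = edges_of_walk ys"
  have nth: "xs ! i = ys ! i" if "i < n" for i
  proof -
    have "rungs ! (xs ! i) = rungs ! (ys ! i)"
      using rung_of_edges_of_walk[OF xs that] rung_of_edges_of_walk[OF ys that] eq by simp
    then show ?thesis
      using nth_eq_iff_index_eq[OF distinct_rungs] closed_rung_walksD(2)[OF xs, of i]
        closed_rung_walksD(2)[OF ys, of i] that by (auto simp: length_rungs)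
  qed
  have "xs ! i = ys ! i" if "i < Suc n" for i
  proof (cases i)
    case 0
    then show ?thesis using nth n3 by auto
  next
    case (Suc l)
    then show ?thesis
      using that nth nx_less closed_rung_walksD(3)[OF xs] closed_rung_walksD(3)[OF ys] by auto
  qed
  then show "xs = ys"
    using closed_rung_walksD(1)[OF xs] closed_rung_walksD(1)[OF ys] by (auto intro: nth_equalityI)
qed

lemma ex_walk_if_maximal:
  assumes M: "M \<subseteq> E" "disjoint_edges M" "dominates_edges M"
  shows "\<exists>xs\<in>closed_rung_walks. edges_of_walk xs = M"
proof -
  have "\<exists>c<9. rungs ! c = rung_of M i" if "i < n" for i
  proof -
    have "rung_ok (rung_of M i)"
      using rung_ok_if_maximal[OF M pr_less[OF that]] nx_pr[OF that] by simp
    then have "rung_of M i \<in> set rungs" using set_rungs by auto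
    then show ?thesis by (auto simp: in_set_conv_nth length_rungs)
  qed
  then obtain c where c: "\<And>i. i < n \<Longrightarrow> c i < 9 \<and> rungs ! c i = rung_of M i" by metis
  \<comment> \<open>Entry \<open>n\<close> repeats the state of rung 0, which closes the
    walk.\<close>
  define xs where "xs = map (\<lambda>i. c (i mod n)) [0..<Suc n]"
  have len: "length xs = Suc n" by (simp add: xs_def)
  have nth: "xs ! i = c (i mod n)" if "i \<le> n" for i
    using that unfolding xs_def by (subst nth_map) (auto simp: less_Suc_eq_le simp del: upt_Suc)
  have nth_lt: "rungs ! (xs ! i) = rung_of M i" if "i < n" for i
    using that nth[of i] c by simp
  have nth_Suc: "rungs ! (xs ! Suc i) = rung_of M (nx i)" if "i < n" for i
    using that nth[of "Suc i"] c nx_less by (simp add: nx_def)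
  have hex: "hex_ok (k i) (\<lambda>j. edge i j \<in> M) (rung_of M i) (rung_of M (nx i))" if "i < n" for i
    by (rule hex_ok_if_maximal[OF M that])
  have step: "hex_step (ms ! i) (rung_of M i) (rung_of M (nx i))" if "i < n" for i
    using hex_step_if_hex_ok hex_interface_rung_of[OF that] hex[OF that] unfolding k_def by blast
  have "set xs \<subseteq> {..<9}" using c n3 unfolding xs_def by auto
  moreover have "hd xs = last xs"
    using nth[of 0] nth[of n] len hd_conv_nth[of xs] last_conv_nth[of xs] n3 by (cases xs) auto
  ultimately have xs: "xs \<in> closed_rung_walks"
    using len length_ms step nth_lt nth_Suc by (auto simp: closed_rung_walks_def walks_def)
  \<comment> \<open>By uniqueness of the filling, the walk gives back \<open>M\<close> itself and
    not just some set with the same states.\<close>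
  have fill: "edge i j \<in> M \<longleftrightarrow> hex_fill (k i) (rung_of M i) (rung_of M (nx i)) j" if "i < n" "j < 6" for i j
    using hex_fill_unique[OF k_def hex_interface_rung_of[OF that(1)] hex[OF that(1)] that(2)] .
  have "edges_of_walk xs = {edge i j | i j. i < n \<and> j < 6 \<and> edge i j \<in> M}"
  proof -
    have "hex_fill (k i) (rungs ! (xs ! i)) (rungs ! (xs ! nx i)) j \<longleftrightarrow> edge i j \<in> M"
      if "i < n" "j < 6" for i j
      using fill[OF that] nth_lt[OF that(1)] nth_lt[OF nx_less[OF that(1)]] by simp
    then show ?thesis unfolding edges_of_walk_def by blast
  qed
  also have "\<dots> = M" using M(1) by (blast elim: E_E)
  finally show ?thesis using xs by blast
qed

lemma card_maximal: "card {M. M \<subseteq> E \<and> disjoint_edges M \<and> dominates_edges M} = card closed_rung_walks"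
proof -
  have "{M. M \<subseteq> E \<and> disjoint_edges M \<and> dominates_edges M} = edges_of_walk ` closed_rung_walks"
    using ex_walk_if_maximal edges_of_walk_maximal by auto
  then show ?thesis using card_image[OF inj_edges_of_walk] by simp
qed

end

section \<open>Hexagonal rings\<close>

text \<open>An edge that meets no member of \<open>M\<close> could be added to \<open>M\<close>;
  conversely, an extra edge in a larger matching would meet a member of \<open>M\<close>.\<close>

lemma is_maximal_matching_iff:
  "is_maximal_matching G M \<longleftrightarrow> M \<subseteq> graph_edges G \<and>
     (\<forall>a\<in>M. \<forall>b\<in>M. a \<noteq> b \<longrightarrow> a \<inter> b = {}) \<and> (\<forall>a\<in>graph_edges G. a \<inter> \<Union>M \<noteq> {})"
proof
  assume max: "is_maximal_matching G M"
  then have M: "M \<subseteq> graph_edges G" "\<forall>a\<in>M. \<forall>b\<in>M. a \<noteq> b \<longrightarrow> a \<inter> b = {}"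
    by (auto simp: is_maximal_matching_def is_matching_def)
  have "a \<inter> \<Union>M \<noteq> {}" if a: "a \<in> graph_edges G" for a
  proof
    assume disj: "a \<inter> \<Union>M = {}"
    \<comment> \<open>An edge in \<open>M\<close> that is disjoint from the union of
      \<open>M\<close> would be empty, so \<open>a\<close> is really new.\<close>
    have "a \<noteq> {}" using a by (auto simp: graph_edges_def dart_edge_def)
    then have "a \<notin> M" using disj by auto
    moreover have "is_matching G (insert a M)"
      using M a disj by (auto simp: is_matching_def)
    ultimately show False
      using max by (auto simp: is_maximal_matching_def)
  qed
  then show "M \<subseteq> graph_edges G \<and>
     (\<forall>a\<in>M. \<forall>b\<in>M. a \<noteq> b \<longrightarrow> a \<inter> b = {}) \<and> (\<forall>a\<in>graph_edges G. a \<inter> \<Union>M \<noteq> {})"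
    using M by blast
next
  assume M: "M \<subseteq> graph_edges G \<and>
     (\<forall>a\<in>M. \<forall>b\<in>M. a \<noteq> b \<longrightarrow> a \<inter> b = {}) \<and> (\<forall>a\<in>graph_edges G. a \<inter> \<Union>M \<noteq> {})"
  have no_larger: False if M': "is_matching G M'" "M \<subset> M'" for M'
  proof -
    obtain a where a: "a \<in> M'" "a \<notin> M" using M' by auto
    then have "a \<inter> \<Union>M \<noteq> {}" using M M' by (auto simp: is_matching_def)
    then obtain b where b: "b \<in> M" "a \<inter> b \<noteq> {}" by auto
    have "a \<noteq> b" "b \<in> M'" using a b M'(2) by auto
    then show False using a(1) b(2) M'(1) by (simp add: is_matching_def)
  qed
  have "is_matching G M" using M by (simp add: is_matching_def)
  then show "is_maximal_matching G M"
    unfolding is_maximal_matching_def using no_larger by blast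
qed

section \<open>Hexagonal faces as 6-cycles of darts\<close>

lemma fst_rot:
  assumes "plane_graph G rot" "d \<in> parcs G"
  shows "fst (rot d) = fst d"
proof -
  interpret pair_graph G using assms(1) by (simp add: plane_graph_def)
  have out: "d \<in> out_arcs (with_proj G) (fst d)" using assms(2) by (simp add: out_arcs_def)
  have "fst d \<in> pverts G" using assms(2) by (rule arc_fst_in_verts)
  then have "cyclic_on rot (out_arcs (with_proj G) (fst d))"
    using assms(1) out unfolding plane_graph_def by blast
  then have "rot d \<in> out_arcs (with_proj G) (fst d)" using out by (rule cyclic_on_inI)
  then show ?thesis by simp
qed

lemma face_step_in_parcs:
  assumes "plane_graph G rot" "d \<in> parcs G"
  shows "face_step rot d \<in> parcs G" "fst (face_step rot d) = snd d"
proof -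
  interpret pair_graph G using assms(1) by (simp add: plane_graph_def)
  have swap: "prod.swap d \<in> parcs G" using assms(2) arcs_symmetric by (cases d) auto
  then show "fst (face_step rot d) = snd d"
    using fst_rot[OF assms(1) swap] by (simp add: face_step_def)
  have "rot permutes parcs G" using assms(1) by (simp add: plane_graph_def)
  then show "face_step rot d \<in> parcs G"
    using swap by (simp add: face_step_def permutes_in_image)
qed

text \<open>Outside the darts of \<open>G\<close>, \<open>face_step rot\<close> still swaps the two
  components, so it need not be a permutation in the sense of \<open>permutes\<close>. Its
  restriction to the finite set of darts is one, with the same orbits there.\<close>

lemma face_cyclic:
  assumes "plane_graph G rot" "F \<in> faces G rot"
  shows "cyclic_on (face_step rot) F" "F \<subseteq> parcs G"
proof -
  interpret pair_graph G using assms(1) by (simp add: plane_graph_def)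
  let ?f = "face_step rot" and ?g = "perm_restrict (face_step rot) (parcs G)"
  obtain d where d: "d \<in> parcs G" "F = orbit ?f d" using assms(2) by (auto simp: faces_def)
  have "rot permutes parcs G" using assms(1) by (simp add: plane_graph_def)
  then have "inj ?f" unfolding face_step_def by (intro inj_compose) (auto intro: permutes_inj)
  then have inj: "inj_on ?f (parcs G)" by (rule inj_on_subset) auto
  have sub: "?f ` parcs G \<subseteq> parcs G" using face_step_in_parcs[OF assms(1)] by auto
  have "bij_betw ?f (parcs G) (parcs G)"
    using endo_inj_surj[OF pair_finite_arcs sub inj] inj by (simp add: bij_betw_def)
  then have "bij_betw ?g (parcs G) (parcs G)"
    by (rule bij_betw_cong[THEN iffD1, rotated]) (simp add: perm_restrict_simps)
  then have perm: "?g permutes parcs G"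
    by (rule bij_imp_permutes) (simp add: perm_restrict_simps)
  have orb: "orbit ?f d = orbit ?g d"
    using d(1) sub by (intro orbit_cong0[of _ "parcs G"]) (auto simp: perm_restrict_simps)
  show sub: "F \<subseteq> parcs G"
    unfolding d(2) orb using perm d(1) by (rule permutes_orbit_subset)
  have "cyclic_on ?g F"
    unfolding d(2) orb using perm pair_finite_arcs by (rule cyclic_on_orbit)
  moreover have "?f d = ?g d" if "d \<in> F" for d
    using sub that by (auto simp: perm_restrict_def)
  ultimately show "cyclic_on ?f F" using cyclic_cong[of F ?f ?g] by blast
qed

text \<open>Six darts make the return time of the orbit 6; six tails make the tails
  distinct.\<close>

lemma hexagon_param:
  assumes "plane_graph G rot" "is_hexagon G rot F" "d \<in> F"
  shows "F = (\<lambda>j. (face_step rot ^^ j) d) ` {..<6}" "inj_on fst F"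
    "inj_on (\<lambda>j. fst ((face_step rot ^^ j) d)) {..<6}" "(face_step rot ^^ 6) d = d"
    "fst ((face_step rot ^^ Suc j) d) = snd ((face_step rot ^^ j) d)"
proof -
  let ?f = "face_step rot"
  have F: "F \<in> faces G rot" "card F = 6" "card (fst ` F) = 6"
    using assms(2) by (auto simp: is_hexagon_def face_verts_def)
  note cyc = face_cyclic[OF assms(1) F(1)]
  have orb: "orbit ?f d = F" using cyc(1) assms(3) by (rule orbit_cyclic_eq3)
  then have self: "d \<in> orbit ?f d" using assms(3) by simp
  have F_eq: "F = (\<lambda>j. (?f ^^ j) d) ` {0..<funpow_dist1 ?f d d}"
    using orbit_conv_funpow_dist1[OF self] orb by simp
  have inj: "inj_on (\<lambda>j. (?f ^^ j) d) {0..<funpow_dist1 ?f d d}"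
    using self by (rule inj_on_funpow_dist1)
  have six: "funpow_dist1 ?f d d = 6"
    using card_image[OF inj] F(2) F_eq by (metis card_atLeastLessThan diff_zero)
  show F6: "F = (\<lambda>j. (?f ^^ j) d) ` {..<6}"
    using F_eq unfolding six by (simp add: atLeast0LessThan)
  show "(?f ^^ 6) d = d" using funpow_dist1_prop[OF self] unfolding six .
  have "finite F" using F(2) by (simp add: card_ge_0_finite)
  then show inj_fst: "inj_on fst F" using F by (intro eq_card_imp_inj_on) auto
  have "inj_on (fst \<circ> (\<lambda>j. (?f ^^ j) d)) {..<6}"
    using inj inj_fst F6 unfolding six atLeast0LessThan by (intro comp_inj_on) auto
  then show "inj_on (\<lambda>j. fst ((?f ^^ j) d)) {..<6}" by (simp add: comp_def)
  have "(?f ^^ j) d \<in> F" using cyc(1) assms(3) by (rule cyclic_on_funpow_in)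
  then show "fst ((?f ^^ Suc j) d) = snd ((?f ^^ j) d)"
    using face_step_in_parcs(2)[OF assms(1) subsetD[OF cyc(2)]] by simp
qed

text \<open>Two darts of one edge in a face would be opposite. Since tails determine darts, the
  second would be the successor of the first, and the boundary would return to its first vertex
  after two steps instead of six.\<close>

lemma hexagon_dart_edge_inj:
  assumes "plane_graph G rot" "is_hexagon G rot F"
  shows "inj_on dart_edge F"
proof
  fix c d assume cd: "c \<in> F" "d \<in> F" "dart_edge c = dart_edge d"
  let ?f = "face_step rot"
  note param = hexagon_param[OF assms cd(1)]
  have mem: "?f c \<in> F" using param(1) image_eqI[of "?f c" "\<lambda>j. (?f ^^ j) c" 1] by auto
  show "c = d"
  proof (rule ccontr)
    assume "c \<noteq> d"
    then have "fst c \<noteq> fst d" using param(2) cd by (metis inj_onD)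
    then have "fst d = snd c" "snd d = fst c"
      using cd(3) by (auto simp: dart_edge_def doubleton_eq_iff)
    moreover have "fst (?f c) = snd c" using param(5)[of 0] by simp
    ultimately have "d = ?f c" using param(2) cd(2) mem by (metis inj_onD)
    then have "fst ((?f ^^ 2) c) = fst ((?f ^^ 0) c)"
      using param(5)[of 1] \<open>snd d = fst c\<close> by (simp add: numeral_2_eq_2)
    then show False using inj_onD[OF param(3), of 2 0] by simp
  qed
qed

section \<open>From the plane graph to the numbered cycle of hexagons\<close>

lemma hexagonal_ring_imp_hexagon_cycle:
  assumes ring: "hexagonal_ring G rot n H e" and type: "has_ring_type rot n H e Ms"
  shows "\<exists>w. hexagon_cycle (graph_edges G) n w Ms"
proof -
  let ?f = "face_step rot" and ?nx = "\<lambda>i. Suc i mod n" and ?k = "\<lambda>i. attachment_size (Ms ! i)"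
  note ring' = ring[unfolded hexagonal_ring_def]
  have plane: "plane_graph G rot" and n3: "3 \<le> n"
    and edges: "graph_edges G = (\<Union>i<n. face_edges (H i))"
    using ring' by simp_all
  have hex: "is_hexagon G rot (H i)" if "i < n" for i
    using ring' that by simp
  have common: "face_edges (H i) \<inter> face_edges (H (?nx i)) = {e (?nx i)} \<and>
      face_verts (H i) \<inter> face_verts (H (?nx i)) = e (?nx i)" if "i < n" for i
    using ring' that by simp
  note common_edges = conjunct1[OF common] and common_verts = conjunct2[OF common]
  have apart: "face_verts (H i) \<inter> face_verts (H j) = {}"
    if "i < n" "j < n" "i \<noteq> j" "j \<noteq> ?nx i" "i \<noteq> ?nx j" for i j
    using ring' that by simp
  have len: "length Ms = n"
    and dist: "\<And>i. i < n \<Longrightarrow> edges_between rot (H i) (e i) (e (?nx i)) = ?k i"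
    using type unfolding has_ring_type_def by blast+
  have nx_less: "?nx i < n" for i using n3 by simp
  have e_next: "e (?nx i) \<in> face_edges (H i)" if "i < n" for i
    using common_edges[OF that] by blast
  have e_prev: "e i \<in> face_edges (H i)" if "i < n" for i
  proof -
    have "?nx (if i = 0 then n - 1 else i - 1) = i" "(if i = 0 then n - 1 else i - 1) < n"
      using that by auto
    then show ?thesis using common_edges by (metis Int_iff singletonI)
  qed
  have "\<exists>d. d \<in> H i \<and> dart_edge d = e i" if "i < n" for i
    using e_prev[OF that] by (auto simp: face_edges_def)
  then obtain d where d: "\<And>i. i < n \<Longrightarrow> d i \<in> H i" "\<And>i. i < n \<Longrightarrow> dart_edge (d i) = e i" by metis
  have "\<exists>d. d \<in> H i \<and> dart_edge d = e (?nx i)" if "i < n" for i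
    using e_next[OF that] by (auto simp: face_edges_def)
  then obtain c where c: "\<And>i. i < n \<Longrightarrow> c i \<in> H i" "\<And>i. i < n \<Longrightarrow> dart_edge (c i) = e (?nx i)" by metis
  note param = hexagon_param[OF plane hex d(1)]
  \<comment> \<open>\<open>edges_between\<close> counts from the dart after \<open>d i\<close>,
    hence the additional step.\<close>
  have c_eq: "(?f ^^ Suc (?k i)) (d i) = c i" if "i < n" for i
  proof -
    have inj: "inj_on dart_edge (H i)" by (rule hexagon_dart_edge_inj[OF plane hex[OF that]])
    have the: "(THE x. x \<in> H i \<and> dart_edge x = e i) = d i"
      "(THE x. x \<in> H i \<and> dart_edge x = e (?nx i)) = c i"
      using d[OF that] c[OF that] inj by (intro the_equality; metis inj_onD)+
    have cyc: "cyclic_on ?f (H i)"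
      using face_cyclic(1)[OF plane] hex[OF that] by (simp add: is_hexagon_def)
    have "?f (d i) \<in> H i" using cyc d(1)[OF that] by (rule cyclic_on_inI)
    then have "c i \<in> orbit ?f (?f (d i))" using c(1)[OF that] orbit_cyclic_eq3[OF cyc] by simp
    then have "(?f ^^ funpow_dist ?f (?f (d i)) (c i)) (?f (d i)) = c i" by (rule funpow_dist_prop)
    then show ?thesis
      using dist[OF that] by (simp add: edges_between_def the funpow_swap1)
  qed
  \<comment> \<open>Distinct faces contain opposite darts of a common edge; this keeps the \<open>u\<close>- and \<open>v\<close>-ends of
    consecutive rungs on the same side, i.e. the ring is not twisted.\<close>
  have c_swap: "c i = prod.swap (d (?nx i))" if "i < n" for i
  proof -
    have "c i \<noteq> d (?nx i)"
    proof
      assume eq: "c i = d (?nx i)"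
      have "cyclic_on ?f (H i)" "cyclic_on ?f (H (?nx i))"
        using face_cyclic(1)[OF plane] hex[OF that] hex[OF nx_less] by (simp_all add: is_hexagon_def)
      then have "H i = H (?nx i)"
        using orbit_cyclic_eq3 c(1)[OF that] d(1)[OF nx_less] eq by metis
      \<comment> \<open>A common dart makes the two faces equal, with six common edges where only
        one is allowed.\<close>
      then have "card (face_edges (H i)) = 1" using common_edges[OF that] by simp
      moreover have "card (face_edges (H i)) = 6"
        using card_image[OF hexagon_dart_edge_inj[OF plane hex[OF that]]] hex[OF that]
        by (simp add: face_edges_def is_hexagon_def)
      ultimately show False by simp
    qed
    moreover have "dart_edge (c i) = dart_edge (d (?nx i))" using c(2)[OF that] d(2)[OF nx_less] by simp
    ultimately show ?thesis
      by (cases "c i"; cases "d (?nx i)") (auto simp: dart_edge_def doubleton_eq_iff)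
  qed
  \<comment> \<open>Counting from the dart on \<open>e i\<close> makes the near rung edge 0, and by
    \<open>c_eq\<close> the far rung is edge \<open>?k i + 1\<close>.\<close>
  define w where "w i j = fst ((?f ^^ j) (d i))" for i j
  have edge: "dart_edge ((?f ^^ j) (d i)) = {w i j, w i (Suc j)}" if "i < n" for i j
    using param(5)[OF that that, of j] by (simp add: dart_edge_def w_def)
  have verts: "face_verts (H i) = w i ` {..<6}" if "i < n" for i
    unfolding face_verts_def by (subst param(1)[OF that that]) (auto simp: w_def)
  have w_inj: "inj_on (w i) {..<6}" if "i < n" for i
    using param(3)[OF that that] by (simp add: w_def[abs_def])
  have wv: "w i (Suc (?k i)) = fst (c i)" if "i < n" for i
    using c_eq[OF that] by (simp add: w_def)
  have wu: "w i (Suc (Suc (?k i))) = snd (c i)" if "i < n" for i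
    using c_eq[OF that] param(5)[OF that that, of "Suc (?k i)"] by (simp add: w_def)
  have "hexagon_cycle (graph_edges G) n w Ms"
  proof
    show "3 \<le> n" "length Ms = n" by fact+
    show "graph_edges G = {{w i j, w i (Suc j)} | i j. i < n \<and> j < 6}"
    proof -
      have "face_edges (H i) = {{w i j, w i (Suc j)} | j. j < 6}" if "i < n" for i
        unfolding face_edges_def by (subst param(1)[OF that that]) (auto simp: image_image edge[OF that])
      then show ?thesis unfolding edges by auto
    qed
  next
    fix i assume i: "i < n"
    show "w i 6 = w i 0" using param(4)[OF i i] by (simp add: w_def)
    show "inj_on (w i) {..<6}" using w_inj[OF i] .
    show "w i (?k i + 1) = w (?nx i) 1"
      using wv[OF i] c_swap[OF i] param(5)[OF nx_less nx_less, of 0 i] by (simp add: w_def)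
    show "w i (?k i + 2) = w (?nx i) 0"
      using wu[OF i] c_swap[OF i] by (simp add: w_def)
  next
    fix i j j' assume i: "i < n" and j: "j < (6::nat)" "j' < (6::nat)" and eq: "w i j = w (?nx i) j'"
    have "w i j \<in> face_verts (H i)" using verts[OF i] j by auto
    moreover have "w i j \<in> face_verts (H (?nx i))" unfolding eq using verts[OF nx_less] j by auto
    ultimately have "w i j \<in> e (?nx i)" using common_verts[OF i] by blast
    then have "w i j = w i (Suc (?k i)) \<or> w i j = w i (Suc (Suc (?k i)))"
      using c(2)[OF i] wv[OF i] wu[OF i] by (auto simp: dart_edge_def)
    then show "j = ?k i + 1 \<or> j = ?k i + 2"
      using inj_onD[OF w_inj[OF i]] j attachment_size_bounds[of "Ms ! i"] by fastforce
  next
    fix i i' j j' assume "i < n" "i' < n" "i \<noteq> i'" "i' \<noteq> ?nx i" "i \<noteq> ?nx i'"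
      and j: "j < (6::nat)" "j' < (6::nat)"
    then have "face_verts (H i) \<inter> face_verts (H i') = {}" by (intro apart)
    then show "w i j \<noteq> w i' j'" using verts[OF \<open>i < n\<close>] verts[OF \<open>i' < n\<close>] j by auto
  qed
  then show ?thesis by blast
qed

theorem theorem1:
  fixes G :: "'a pair_pre_digraph" and rot :: "'a \<times> 'a \<Rightarrow> 'a \<times> 'a" and n :: nat
    and H :: "nat \<Rightarrow> ('a \<times> 'a) set" and e :: "nat \<Rightarrow> 'a set" and Ms :: "attachment list"
  assumes "hexagonal_ring G rot n H e"
    and "has_ring_type rot n H e Ms"
  shows "int (num_maximal_matchings G) = mat_trace (foldr (*) (map attachment_mat Ms) (1\<^sub>m 9))"
proof -
  obtain w where "hexagon_cycle (graph_edges G) n w Ms"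
    using hexagonal_ring_imp_hexagon_cycle[OF assms] by blast
  then interpret hexagon_cycle "graph_edges G" n w Ms .
  have "num_maximal_matchings G = card closed_rung_walks"
    using card_maximal
    by (simp add: num_maximal_matchings_def is_maximal_matching_iff disjoint_edges_def dominates_edges_def)
  moreover have "Ms \<noteq> []" using n3 length_ms by auto
  ultimately show ?thesis
    using mat_trace_attachments[of Ms] by (simp add: closed_rung_walks_def)
qed

end
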